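(* For every natural number $m\ge 1$, every linear order $(L,\prec)$ that is $m$-dimensionally interpretable in $(\mathbb{N},+)$ has $VD_*$-rank at most $m$.
   Context: A linear order $(L,\prec)$ is $m$-dimensionally interpretable in $(\mathbb{N},+)$ if there are first-order formulas $D(\bar x)$, $E(\bar x,\bar y)$, $R(\bar x,\bar y)$ over the signature $\{=,+\}$ (without parameters; $\bar x,\bar y$ tuples of $m$ variables) such that $D$ defines a nonempty set $D^*\subseteq\mathbb{N}^m$, $E$ defines an equivalence relation $\sim$ on $D^*$, and there is a bijection $h:D^*/{\sim}\to L$ with $h([\bar a])\prec h([\bar b])$ iff $(\mathbb{N},+)\models R(\bar a,\bar b)$ for all $\bar a,\bar b\in D^*$. For a linear order $(L,\prec)$ define equivalence relations $\simeq_\alpha$ on $L$ for ordinals $\alpha$: $\simeq_0$ is equality; $\simeq_\lambda=\bigcup_{\beta<\lambda}\simeq_\beta$ for limit $\lambda$; $a\simeq_{\alpha+1}b$ iff the set $\{c\in L\mid a\prec c\prec b\text{ or }b\prec c\prec a\}/{\simeq_\alpha}$ is finite. The $VD_*$-rank of $(L,\prec)$ is the least ordinal $\alpha$ such that $L/{\simeq_\alpha}$ is finite, and is $\infty$ (greater than all ordinals) if no such $\alpha$ exists. *)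

theory Defs
  imports Main "HOL-Library.Extended"
begin

section \<open>First-order logic over the signature of equality and addition\<close>

datatype tm = Var nat | Plus tm tm

datatype fm = Eq tm tm | Neg fm | Conj fm fm | Disj fm fm | Ex nat fm | All nat fm

primrec fv_tm :: "tm \<Rightarrow> nat set" where
  "fv_tm (Var x) = {x}"
| "fv_tm (Plus s t) = fv_tm s \<union> fv_tm t"

primrec fv :: "fm \<Rightarrow> nat set" where
  "fv (Eq s t) = fv_tm s \<union> fv_tm t"
| "fv (Neg \<phi>) = fv \<phi>"
| "fv (Conj \<phi> \<psi>) = fv \<phi> \<union> fv \<psi>"
| "fv (Disj \<phi> \<psi>) = fv \<phi> \<union> fv \<psi>"
| "fv (Ex x \<phi>) = fv \<phi> - {x}"
| "fv (All x \<phi>) = fv \<phi> - {x}"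

primrec eval_tm :: "(nat \<Rightarrow> nat) \<Rightarrow> tm \<Rightarrow> nat" where
  "eval_tm e (Var x) = e x"
| "eval_tm e (Plus s t) = eval_tm e s + eval_tm e t"

primrec sat :: "(nat \<Rightarrow> nat) \<Rightarrow> fm \<Rightarrow> bool" where
  "sat e (Eq s t) \<longleftrightarrow> eval_tm e s = eval_tm e t"
| "sat e (Neg \<phi>) \<longleftrightarrow> \<not> sat e \<phi>"
| "sat e (Conj \<phi> \<psi>) \<longleftrightarrow> sat e \<phi> \<and> sat e \<psi>"
| "sat e (Disj \<phi> \<psi>) \<longleftrightarrow> sat e \<phi> \<or> sat e \<psi>"
| "sat e (Ex x \<phi>) \<longleftrightarrow> (\<exists>v. sat (e(x := v)) \<phi>)"
| "sat e (All x \<phi>) \<longleftrightarrow> (\<forall>v. sat (e(x := v)) \<phi>)"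

text \<open>Tuples are lists: entry number \<open>i\<close> is the value of variable \<open>i\<close>. The value 0 beyond the
  end of the list is never consulted, because the free variables are restricted below.\<close>

definition holds :: "fm \<Rightarrow> nat list \<Rightarrow> bool" where
  "holds \<phi> xs \<longleftrightarrow> sat (\<lambda>i. if i < length xs then xs ! i else 0) \<phi>"


section \<open>Interpretations of linear orders\<close>

definition dom_set :: "nat \<Rightarrow> fm \<Rightarrow> nat list set" where
  "dom_set m D = {xs. length xs = m \<and> holds D xs}"

definition eq_rel :: "nat \<Rightarrow> fm \<Rightarrow> fm \<Rightarrow> nat list rel" where
  "eq_rel m D E = {(xs, ys). xs \<in> dom_set m D \<and> ys \<in> dom_set m D \<and> holds E (xs @ ys)}"

text \<open>A linear order is given by its carrier \<open>L\<close> and its strict relation \<open>r\<close>.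
  In \<open>E\<close> and \<open>R\<close> the first tuple occupies the variables below \<open>m\<close>, the second one the
  variables from \<open>m\<close> up to \<open>2 * m - 1\<close>.\<close>

definition interpretable :: "nat \<Rightarrow> 'a set \<Rightarrow> 'a rel \<Rightarrow> bool" where
  "interpretable m L r \<longleftrightarrow>
    (\<exists>D E R.
      fv D \<subseteq> {..<m} \<and> fv E \<subseteq> {..<2 * m} \<and> fv R \<subseteq> {..<2 * m} \<and>
      dom_set m D \<noteq> {} \<and>
      equiv (dom_set m D) (eq_rel m D E) \<and>
      (\<exists>h. bij_betw h (dom_set m D // eq_rel m D E) L \<and>
        (\<forall>a \<in> dom_set m D. \<forall>b \<in> dom_set m D.
          (h (eq_rel m D E `` {a}), h (eq_rel m D E `` {b})) \<in> r \<longleftrightarrow> holds R (a @ b))))"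


section \<open>The condensation relations\<close>

definition between :: "'a set \<Rightarrow> 'a rel \<Rightarrow> 'a \<Rightarrow> 'a \<Rightarrow> 'a set" where
  "between L r a b =
    {c \<in> L. ((a, c) \<in> r \<and> (c, b) \<in> r) \<or> ((b, c) \<in> r \<and> (c, a) \<in> r)}"

definition condense :: "'a set \<Rightarrow> 'a rel \<Rightarrow> 'a rel \<Rightarrow> 'a rel" where
  "condense L r q = {(a, b). a \<in> L \<and> b \<in> L \<and> finite (between L r a b // q)}"

definition is_pred :: "'o::wellorder \<Rightarrow> 'o \<Rightarrow> bool" where
  "is_pred \<beta> \<alpha> \<longleftrightarrow> \<beta> < \<alpha> \<and> (\<forall>\<gamma><\<alpha>. \<gamma> \<le> \<beta>)"

lemma is_pred_The: "is_pred \<beta> \<alpha> \<Longrightarrow> (THE \<gamma>. is_pred \<gamma> \<alpha>) = \<beta>"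
  by (rule the_equality) (auto simp: is_pred_def intro: order.antisym)

text \<open>The recursion makes sense along every well-ordered type; it is only used for the type of
  ordinals introduced below.\<close>

function VD_rel :: "'a set \<Rightarrow> 'a rel \<Rightarrow> 'o::wellorder \<Rightarrow> 'a rel" where
  "VD_rel L r \<alpha> =
    (if \<exists>\<beta>. is_pred \<beta> \<alpha> then condense L r (VD_rel L r (THE \<beta>. is_pred \<beta> \<alpha>))
     else if \<exists>\<beta>. \<beta> < \<alpha> then \<Union>\<beta>\<in>{..<\<alpha>}. VD_rel L r \<beta>
     else Id_on L)"
  by auto
termination
proof (relation "inv_image {(x, y). x < y} (\<lambda>(L, r, \<alpha>). \<alpha>)", goal_cases)
  case 1
  then show ?case by (intro wf_inv_image wf)
next
  case (2 L r \<alpha>)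
  then show ?case by (auto simp: is_pred_The) (auto simp: is_pred_def)
next
  case 3
  then show ?case by auto
qed

declare VD_rel.simps [simp del]

lemma VD_rel_zero:
  assumes "\<And>\<beta>. \<alpha> \<le> \<beta>"
  shows "VD_rel L r \<alpha> = Id_on L"
proof -
  have "\<not> \<beta> < \<alpha>" for \<beta>
    using assms[of \<beta>] by (rule leD)
  then show ?thesis
    unfolding VD_rel.simps[of L r \<alpha>] is_pred_def by simp
qed

lemma VD_rel_succ:
  assumes "is_pred \<beta> \<alpha>"
  shows "VD_rel L r \<alpha> = condense L r (VD_rel L r \<beta>)"
  unfolding VD_rel.simps[of L r \<alpha>] is_pred_The[OF assms] using assms by auto

lemma VD_rel_limit:
  assumes "\<exists>\<beta>. \<beta> < \<alpha>" and "\<nexists>\<beta>. is_pred \<beta> \<alpha>"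
  shows "VD_rel L r \<alpha> = (\<Union>\<beta><\<alpha>. VD_rel L r \<beta>)"
  unfolding VD_rel.simps[of L r \<alpha>] if_not_P[OF assms(2)] if_P[OF assms(1)] ..


section \<open>Ordinals\<close>

text \<open>The order types of well-orders on subsets of a type.\<close>

quotient_type 'b ordinal = "'b rel" / partial: "\<lambda>s t. (s, t) \<in> ordIso"
proof (rule part_equivpI)
  show "\<exists>s :: 'b rel. (s, s) \<in> ordIso"
    by (rule exI[of _ "{}"]) (simp add: ordIso_reflexive well_order_on_empty)
  show "symp (\<lambda>s t :: 'b rel. (s, t) \<in> ordIso)"
    by (intro sympI) (rule ordIso_symmetric)
  show "transp (\<lambda>s t :: 'b rel. (s, t) \<in> ordIso)"
    by (intro transpI) (rule ordIso_transitive)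
qed

instantiation ordinal :: (type) wellorder
begin

lift_definition less_eq_ordinal :: "'a ordinal \<Rightarrow> 'a ordinal \<Rightarrow> bool" is
  "\<lambda>s t. (s, t) \<in> ordLeq"
  using ordIso_ordLeq_trans[OF ordIso_symmetric ordLeq_ordIso_trans]
    ordIso_ordLeq_trans[OF _ ordLeq_ordIso_trans[OF _ ordIso_symmetric]] by iprover

lift_definition less_ordinal :: "'a ordinal \<Rightarrow> 'a ordinal \<Rightarrow> bool" is
  "\<lambda>s t. (s, t) \<in> ordLess"
  using ordIso_ordLess_trans[OF ordIso_symmetric ordLess_ordIso_trans]
    ordIso_ordLess_trans[OF _ ordLess_ordIso_trans[OF _ ordIso_symmetric]] by iprover

instance
proof
  fix x y z :: "'a ordinal"
  show "(x < y) = (x \<le> y \<and> \<not> y \<le> x)"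
  proof transfer
    fix s t :: "'a rel"
    assume "(s, s) \<in> ordIso" "(t, t) \<in> ordIso"
    then have "Well_order s" "Well_order t"
      by (simp_all add: ordIso_def)
    then have "(t, s) \<notin> ordLeq \<longleftrightarrow> (s, t) \<in> ordLess"
      by (simp add: not_ordLeq_iff_ordLess)
    then show "((s, t) \<in> ordLess) = ((s, t) \<in> ordLeq \<and> (t, s) \<notin> ordLeq)"
      using ordLess_imp_ordLeq[of s t] by argo
  qed
  show "x \<le> x"
    by transfer (rule ordIso_imp_ordLeq)
  show "x \<le> y \<Longrightarrow> y \<le> z \<Longrightarrow> x \<le> z"
    by transfer (rule ordLeq_transitive)
  show "x \<le> y \<Longrightarrow> y \<le> x \<Longrightarrow> x = y"
    by transfer (simp only: ordIso_iff_ordLeq simp_thms)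
  show "x \<le> y \<or> y \<le> x"
  proof transfer
    fix s t :: "'a rel"
    assume "(s, s) \<in> ordIso" "(t, t) \<in> ordIso"
    then have "Well_order s" "Well_order t"
      by (simp_all add: ordIso_def)
    then show "(s, t) \<in> ordLeq \<or> (t, s) \<in> ordLeq"
      by (rule ordLeq_total)
  qed
next
  fix P :: "'a ordinal \<Rightarrow> bool" and a
  assume step: "\<And>x. (\<And>y. y < x \<Longrightarrow> P y) \<Longrightarrow> P x"
  have "wf {(x, y :: 'a ordinal). x < y}"
  proof (rule wf_subset[OF wf_inv_image[OF wf_ordLess]])
    show "{(x, y :: 'a ordinal). x < y} \<subseteq> inv_image ordLess rep_ordinal"
      by (simp add: less_ordinal_def subset_iff)
  qed
  then show "P a"
    by (rule wf_induct_rule) (rule step, simp)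
qed

end

primrec ord_of_nat :: "nat \<Rightarrow> 'o::wellorder" where
  "ord_of_nat 0 = (LEAST \<alpha>. True)"
| "ord_of_nat (Suc n) = (LEAST \<alpha>. ord_of_nat n < \<alpha>)"


section \<open>The rank\<close>

text \<open>The relations \<open>VD_rel L r \<alpha>\<close> increase with \<open>\<alpha>\<close>, so as subsets of \<open>L \<times> L\<close> they become stationary
  at an ordinal whose cardinality is at most that of \<open>L \<times> L\<close>. Every such ordinal is the order type
  of a well-order on a subset of \<open>'a + nat\<close>, so the minimum below is the minimum over all
  ordinals; the summand \<open>nat\<close> ensures that all natural numbers occur as ordinals. The value \<open>-\<infinity>\<close>
  of the type \<open>extended\<close> is not used.\<close>

definition VD_rank :: "'a set \<Rightarrow> 'a rel \<Rightarrow> ('a + nat) ordinal extended" where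
  "VD_rank L r =
    (if \<exists>\<alpha> :: ('a + nat) ordinal. finite (L // VD_rel L r \<alpha>)
     then Fin (LEAST \<alpha>. finite (L // VD_rel L r \<alpha>))
     else \<infinity>)"

end

theory Submission
  imports Defs "HOL-Library.FuncSet" "HOL-Library.Function_Algebras" "HOL-Decision_Procs.Cooper"
begin

text \<open>
  By quantifier elimination a Presburger definable set is semilinear. The fibres of a semilinear set
  over its parameters are finite unions of translates of finitely many monoids, which do not depend
  on the parameter. Hence a uniformly definable family of sets of tuples has a growth gap: the number
  of tuples in \<open>[0,n]\<^sup>m\<close> is either \<open>O(n\<^sup>d)\<close> or at least \<open>(\<epsilon>n)\<^sup>d\<^sup>+\<^sup>1\<close> for large \<open>n\<close>, with the same
  \<open>\<epsilon>\<close> for all members of the family.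

  One shows by induction on \<open>d\<close> that a convex set of growth \<open>O(n\<^sup>d)\<close> meets only finitely many classes of
  \<open>\<simeq>\<^sub>d\<close>. If a convex set of growth \<open>O(n\<^sup>d\<^sup>+\<^sup>1)\<close> met infinitely many classes of \<open>\<simeq>\<^sub>d\<^sub>+\<^sub>1\<close>, it would contain,
  for every \<open>T\<close>, disjoint intervals \<open>I\<^sub>1, \<dots>, I\<^sub>T\<close> between inequivalent points. Each of them meets infinitely
  many classes of \<open>\<simeq>\<^sub>d\<close>, so it is not of growth \<open>O(n\<^sup>d)\<close>, and by the gap it contains at least
  \<open>(\<epsilon>n)\<^sup>d\<^sup>+\<^sup>1\<close> tuples; for large \<open>T\<close> this is too many.
\<close>

section \<open>Semilinear sets\<close>

inductive_set mon :: "'v::comm_monoid_add set \<Rightarrow> 'v set" for B where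
  mon_zero: "0 \<in> mon B"
| mon_add: "b \<in> B \<Longrightarrow> x \<in> mon B \<Longrightarrow> b + x \<in> mon B"

definition lin :: "'v::comm_monoid_add \<Rightarrow> 'v set \<Rightarrow> 'v set" where
  "lin u B = (+) u ` mon B"

definition semilin :: "'v::comm_monoid_add set \<Rightarrow> bool" where
  "semilin S \<longleftrightarrow> (\<exists>P. finite P \<and> (\<forall>(u, B) \<in> P. finite B) \<and> S = (\<Union>(u, B)\<in>P. lin u B))"

definition monoid_hom :: "('v::comm_monoid_add \<Rightarrow> 'w::comm_monoid_add) \<Rightarrow> bool" where
  "monoid_hom f \<longleftrightarrow> f 0 = 0 \<and> (\<forall>x y. f (x + y) = f x + f y)"

lemma monoid_homI:
  "f 0 = 0 \<Longrightarrow> (\<And>x y. f (x + y) = f x + f y) \<Longrightarrow> monoid_hom f"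
  by (simp add: monoid_hom_def)

lemma mon_plus:
  assumes "x \<in> mon B" "y \<in> mon B"
  shows "x + y \<in> mon B"
  using assms by induct (auto simp: add.assoc intro: mon.intros)

lemma mon_mono:
  assumes "x \<in> mon B" "B \<subseteq> B'"
  shows "x \<in> mon B'"
  using assms by induct (auto intro: mon.intros)

text \<open>Serves in \<open>fibre_lin\<close> to separate the generators that leave the parameters
  alone from those that change them.\<close>

lemma mon_Un: "mon (B \<union> B') = {x + y | x y. x \<in> mon B \<and> y \<in> mon B'}"
proof (intro equalityI subsetI)
  fix z assume "z \<in> mon (B \<union> B')"
  then show "z \<in> {x + y | x y. x \<in> mon B \<and> y \<in> mon B'}"
  proof induct
    case mon_zero
    show ?case by (force intro: mon.mon_zero)
  next
    case (mon_add b z)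
    then obtain x y where xy: "z = x + y" "x \<in> mon B" "y \<in> mon B'" by auto
    from mon_add(1) show ?case
    proof
      assume "b \<in> B"
      then have "b + x \<in> mon B" using xy by (auto intro: mon.mon_add)
      moreover have "b + z = (b + x) + y" using xy by (simp add: add.assoc)
      ultimately show ?case using xy by blast
    next
      assume "b \<in> B'"
      then have "b + y \<in> mon B'" using xy by (auto intro: mon.mon_add)
      moreover have "b + z = x + (b + y)" using xy by (simp add: add.left_commute)
      ultimately show ?case using xy by blast
    qed
  qed
next
  fix z assume "z \<in> {x + y | x y. x \<in> mon B \<and> y \<in> mon B'}"
  then show "z \<in> mon (B \<union> B')"
    by (auto intro!: mon_plus elim: mon_mono)
qed

lemma mon_image:
  assumes "monoid_hom f"
  shows "f ` mon B = mon (f ` B)"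
proof (intro equalityI subsetI)
  fix y assume "y \<in> f ` mon B"
  then obtain x where "x \<in> mon B" "y = f x" by auto
  then show "y \<in> mon (f ` B)"
    using assms by (induct arbitrary: y) (auto simp: monoid_hom_def intro: mon.intros)
next
  fix y assume "y \<in> mon (f ` B)"
  then show "y \<in> f ` mon B"
  proof induct
    case mon_zero
    show ?case using assms mon.mon_zero[of B] by (force simp: monoid_hom_def)
  next
    case (mon_add b y)
    then obtain c x where "c \<in> B" "b = f c" "x \<in> mon B" "y = f x" by auto
    then have "b + y = f (c + x)" "c + x \<in> mon B"
      using assms by (auto simp: monoid_hom_def intro: mon.mon_add)
    then show ?case by blast
  qed
qed

lemma semilin_lin: "finite B \<Longrightarrow> semilin (lin u B)"
  unfolding semilin_def by (rule exI[of _ "{(u, B)}"]) auto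

lemma semilin_empty [simp]: "semilin {}"
  unfolding semilin_def by (rule exI[of _ "{}"]) auto

lemma semilin_Un:
  assumes "semilin S" "semilin S'"
  shows "semilin (S \<union> S')"
proof -
  obtain P P' where "finite P" "\<forall>(u, B) \<in> P. finite B" "S = (\<Union>(u, B)\<in>P. lin u B)"
    "finite P'" "\<forall>(u, B) \<in> P'. finite B" "S' = (\<Union>(u, B)\<in>P'. lin u B)"
    using assms unfolding semilin_def by blast
  then show ?thesis
    unfolding semilin_def by (intro exI[of _ "P \<union> P'"]) auto
qed

lemma semilin_UN:
  assumes "finite I" "\<And>i. i \<in> I \<Longrightarrow> semilin (S i)"
  shows "semilin (\<Union>i\<in>I. S i)"
  using assms by (induct I) (auto intro: semilin_Un)

lemma semilin_affine_image:
  assumes "semilin S" "monoid_hom f"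
  shows "semilin ((\<lambda>x. v + f x) ` S)"
proof -
  obtain P where P: "finite P" "\<forall>(u, B) \<in> P. finite B" "S = (\<Union>(u, B)\<in>P. lin u B)"
    using assms unfolding semilin_def by blast
  have "(\<lambda>x. v + f x) ` lin u B = lin (v + f u) (f ` B)" for u B
    using assms(2) unfolding lin_def mon_image[OF assms(2), symmetric]
    by (auto simp: image_image monoid_hom_def add.assoc)
  then have "(\<lambda>x. v + f x) ` S = (\<Union>(u, B)\<in>P. lin (v + f u) (f ` B))"
    unfolding P by (simp add: image_UN case_prod_beta)
  also have "semilin \<dots>"
    using P by (intro semilin_UN) (auto intro!: semilin_lin)
  finally show ?thesis .
qed

lemma semilin_hom_image:
  assumes "semilin S" "monoid_hom f"
  shows "semilin (f ` S)"
  using semilin_affine_image[OF assms, of 0] by simp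


subsection \<open>Minimal elements and linear equations\<close>

text \<open>Tuples of fixed length are functions that vanish outside \<open>J\<close>. With
  pointwise operations they form a commutative monoid, and tuples of all lengths share one
  type.\<close>

definition supp_in :: "'i set \<Rightarrow> ('i \<Rightarrow> nat) set" where
  "supp_in J = {x. \<forall>i. i \<notin> J \<longrightarrow> x i = 0}"

definition min_elems :: "('i \<Rightarrow> nat) set \<Rightarrow> ('i \<Rightarrow> nat) set" where
  "min_elems X = {x \<in> X. \<forall>y\<in>X. y \<le> x \<longrightarrow> y = x}"

text \<open>Every sequence has a monotone subsequence. If that one is nonincreasing, it is constant
  from the point on where it attains its minimum.\<close>

lemma nat_seq_mono_subseq:
  fixes s :: "nat \<Rightarrow> nat"
  shows "\<exists>g :: nat \<Rightarrow> nat. strict_mono g \<and> mono (\<lambda>n. s (g n))"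
proof -
  obtain f :: "nat \<Rightarrow> nat" where f: "strict_mono f" "monoseq (\<lambda>n. s (f n))"
    using seq_monosub[of s] by blast
  from f(2) show ?thesis
    unfolding monoseq_def
  proof
    assume "\<forall>m n. m \<le> n \<longrightarrow> s (f m) \<le> s (f n)"
    with f(1) show ?thesis by (intro exI[of _ f]) (auto simp: mono_def)
  next
    assume dec: "\<forall>m n. m \<le> n \<longrightarrow> s (f n) \<le> s (f m)"
    obtain N where N: "\<And>n. s (f N) \<le> s (f n)"
      using ex_has_least_nat[of "\<lambda>_. True" 0 "\<lambda>n. s (f n)"] by auto
    have "s (f (N + n)) = s (f N)" for n
      using N[of "N + n"] dec by (simp add: antisym)
    moreover have "strict_mono (\<lambda>n. f (N + n))"
      using f(1) by (simp add: strict_mono_def)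
    ultimately show ?thesis by (intro exI[of _ "\<lambda>n. f (N + n)"]) (simp add: mono_def)
  qed
qed

text \<open>Dickson's lemma for sequences: subsequences are taken for one coordinate after the
  other, and a further subsequence keeps the monotonicity already reached.\<close>

lemma dickson:
  fixes s :: "nat \<Rightarrow> 'i \<Rightarrow> nat"
  assumes "finite J"
  shows "\<exists>g :: nat \<Rightarrow> nat. strict_mono g \<and> (\<forall>i\<in>J. mono (\<lambda>n. s (g n) i))"
  using assms
proof induct
  case empty
  show ?case by (intro exI[of _ "id :: nat \<Rightarrow> nat"]) (auto simp: strict_mono_def)
next
  case (insert j J)
  then obtain g :: "nat \<Rightarrow> nat" where g: "strict_mono g" "\<forall>i\<in>J. mono (\<lambda>n. s (g n) i)" by blast
  obtain h :: "nat \<Rightarrow> nat" where h: "strict_mono h" "mono (\<lambda>n. s (g (h n)) j)"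
    using nat_seq_mono_subseq[of "\<lambda>n. s (g n) j"] by blast
  have "mono (\<lambda>n. s (g (h n)) i)" if "i \<in> J" for i
    using g(2) that strict_mono_mono[OF h(1)] unfolding mono_def by blast
  moreover have "strict_mono (\<lambda>n. g (h n))"
    using g(1) h(1) by (simp add: strict_mono_def)
  ultimately show ?case using h by (intro exI[of _ "\<lambda>n. g (h n)"]) auto
qed

text \<open>A sequence of distinct minimal elements would, by Dickson's lemma, contain two
  comparable ones.\<close>

lemma finite_min_elems:
  assumes "finite J" "X \<subseteq> supp_in J"
  shows "finite (min_elems X)"
proof (rule ccontr)
  assume "infinite (min_elems X)"
  then obtain s :: "nat \<Rightarrow> _" where s: "inj s" "range s \<subseteq> min_elems X"
    using infinite_countable_subset by blast
  obtain g :: "nat \<Rightarrow> nat" where g: "strict_mono g" "\<forall>i\<in>J. mono (\<lambda>n. s (g n) i)"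
    using dickson[OF assms(1)] by blast
  have mem: "s n \<in> X" "s n \<in> supp_in J" for n
    using s(2) assms(2) by (auto simp: min_elems_def)
  have "s (g 0) i \<le> s (g 1) i" for i
    using g(2) mem(2) by (cases "i \<in> J") (auto simp: mono_def supp_in_def)
  then have "s (g 0) = s (g 1)"
    using s(2) mem unfolding min_elems_def le_fun_def by blast
  moreover have "g 0 \<noteq> g 1"
    using g(1) by (metis strict_mono_less less_irrefl zero_less_one)
  ultimately show False using s(1) by (simp add: inj_def)
qed

text \<open>The coordinate sum is the measure for descents in the pointwise order: a strict drop can
  only occur inside \<open>J\<close>.\<close>

lemma supp_in_less_sum:
  assumes "finite J" "x \<in> supp_in J" "y \<le> x" "y \<noteq> x"
  shows "sum y J < sum x J"
proof -
  obtain i where i: "y i \<noteq> x i" using assms(4) by blast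
  then have "y i < x i" using assms(3) by (simp add: le_fun_def order_less_le)
  moreover have "i \<in> J"
    using assms(2) \<open>y i < x i\<close> by (auto simp: supp_in_def)
  ultimately show ?thesis
    using assms by (intro sum_strict_mono_ex1) (auto simp: le_fun_def)
qed

lemma ex_min_elem_below:
  assumes "finite J" "X \<subseteq> supp_in J" "x \<in> X"
  shows "\<exists>y \<in> min_elems X. y \<le> x"
  using assms(3)
proof (induct "sum x J" arbitrary: x rule: less_induct)
  case less
  show ?case
  proof (cases "x \<in> min_elems X")
    case False
    then obtain y where y: "y \<in> X" "y \<le> x" "y \<noteq> x"
      using less(2) unfolding min_elems_def by blast
    then have "\<exists>z \<in> min_elems X. z \<le> y"
      using less assms supp_in_less_sum by (metis subsetD)
    then show ?thesis using y by (blast intro: order_trans)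
  qed auto
qed

lemma fun_le_plus_diff:
  fixes x y :: "'i \<Rightarrow> nat"
  assumes "y \<le> x"
  shows "x = y + (\<lambda>i. x i - y i)"
  using assms by (auto simp: le_fun_def)

text \<open>The solutions are the minimal solutions plus the monoid of solutions of
  \<open>f x = g x\<close>, which is generated by its minimal nonzero elements: subtracting a
  smaller solution leaves a solution of \<open>f x = g x\<close>, by cancellation. Both sets of
  minimal elements are finite. There is a map on either side of the equation because the target need
  not have subtraction.\<close>

lemma semilin_solutions:
  fixes f g :: "('i \<Rightarrow> nat) \<Rightarrow> 'v::cancel_comm_monoid_add"
  assumes J: "finite J" and f: "monoid_hom f" and g: "monoid_hom g"
  shows "semilin {x \<in> supp_in J. u + f x = u' + g x}"
proof -
  define X where "X = {x \<in> supp_in J. u + f x = u' + g x}"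
  \<comment> \<open>With 0 included, 0 would be the only minimal element.\<close>
  define H where "H = {x \<in> supp_in J. x \<noteq> 0 \<and> f x = g x}"
  have fg: "f (x + y) = f x + f y" "g (x + y) = g x + g y" "f 0 = 0" "g 0 = 0" for x y
    using f g by (auto simp: monoid_hom_def)
  have XH: "X \<subseteq> supp_in J" "H \<subseteq> supp_in J" by (auto simp: X_def H_def)
  have H_mon: "x \<in> mon (min_elems H)" if "x \<in> supp_in J" "f x = g x" for x
    using that
  proof (induct "sum x J" arbitrary: x rule: less_induct)
    case less
    show ?case
    proof (cases "x = 0")
      case False
      then have "x \<in> H" using less by (simp add: H_def)
      then obtain h where h: "h \<in> min_elems H" "h \<le> x"
        using ex_min_elem_below[OF J XH(2)] by blast
      define d where "d = (\<lambda>i. x i - h i)"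
      have x: "x = h + d" unfolding d_def using h(2) by (rule fun_le_plus_diff)
      have hH: "h \<noteq> 0" "f h = g h" using h(1) by (auto simp: min_elems_def H_def)
      have d: "d \<in> supp_in J" using less(2) by (auto simp: supp_in_def d_def)
      have "f d = g d" using less(3) hH unfolding x fg by simp
      moreover have "sum d J < sum x J"
        using x hH(1) by (intro supp_in_less_sum J less) (auto simp: d_def le_fun_def)
      ultimately have "d \<in> mon (min_elems H)" using less d by blast
      then show ?thesis unfolding x using h(1) by (rule mon_add[rotated])
    qed (auto intro: mon_zero)
  qed
  have "X = (\<Union>x\<in>min_elems X. lin x (min_elems H))"
  proof (intro equalityI subsetI)
    fix x assume "x \<in> X"
    then obtain h where h: "h \<in> min_elems X" "h \<le> x"
      using ex_min_elem_below[OF J XH(1)] by blast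
    define d where "d = (\<lambda>i. x i - h i)"
    have x: "x = h + d" unfolding d_def using h(2) by (rule fun_le_plus_diff)
    have hX: "u + f h = u' + g h" using h(1) by (auto simp: min_elems_def X_def)
    have "d \<in> supp_in J" using \<open>x \<in> X\<close> by (auto simp: supp_in_def d_def X_def)
    moreover have "u + f h + f d = u' + g h + g d"
      using \<open>x \<in> X\<close> by (simp add: X_def x fg add.assoc)
    then have "f d = g d" unfolding hX by simp
    ultimately have "d \<in> mon (min_elems H)" by (rule H_mon)
    then show "x \<in> (\<Union>x\<in>min_elems X. lin x (min_elems H))"
      using h(1) by (auto simp: lin_def x)
  next
    fix x assume "x \<in> (\<Union>x\<in>min_elems X. lin x (min_elems H))"
    then obtain h d where "x = h + d" "h \<in> X" "d \<in> mon (min_elems H)"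
      by (auto simp: lin_def min_elems_def)
    from this(3,2) have "h + d \<in> X"
    proof (induct arbitrary: h)
      case (mon_add b d)
      then have "h + b \<in> X" by (auto simp: X_def H_def min_elems_def supp_in_def fg add.assoc[symmetric])
      then show ?case using mon_add by (metis add.assoc)
    qed simp
    then show "x \<in> X" using \<open>x = h + d\<close> by simp
  qed
  also have "semilin \<dots>"
    using finite_min_elems[OF J XH(1)] finite_min_elems[OF J XH(2)]
    by (intro semilin_UN semilin_lin)
  finally show ?thesis unfolding X_def .
qed

section \<open>Linear combinations and intersections of semilinear sets\<close>

definition lin_comb :: "('i \<Rightarrow> nat) set \<Rightarrow> (('i \<Rightarrow> nat) \<Rightarrow> nat) \<Rightarrow> 'i \<Rightarrow> nat" where
  "lin_comb B c = (\<lambda>j. \<Sum>b\<in>B. c b * b j)"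

lemma lin_comb_plus: "lin_comb B (c + c') = lin_comb B c + lin_comb B c'"
  by (auto simp: lin_comb_def algebra_simps sum.distrib)

lemma lin_comb_zero: "lin_comb B 0 = 0"
  by (auto simp: lin_comb_def)

lemma mon_conv_lin_comb:
  assumes "finite B"
  shows "mon B = range (lin_comb B)"
proof (intro equalityI subsetI)
  fix x assume "x \<in> mon B"
  then show "x \<in> range (lin_comb B)"
  proof induct
    case mon_zero
    show ?case by (metis lin_comb_zero rangeI)
  next
    case (mon_add b x)
    then obtain c where c: "x = lin_comb B c" by auto
    have "lin_comb B (\<lambda>b'. if b' = b then 1 else 0) = b"
    proof
      fix j
      have "(\<Sum>b'\<in>B. (if b' = b then 1 else 0) * b' j) = (\<Sum>b'\<in>B. if b' = b then b' j else 0)"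
        by (rule sum.cong) auto
      also have "\<dots> = b j" using assms mon_add(1) by simp
      finally show "lin_comb B (\<lambda>b'. if b' = b then 1 else 0) j = b j" by (simp add: lin_comb_def)
    qed
    then have "b + x = lin_comb B ((\<lambda>b'. if b' = b then 1 else 0) + c)"
      by (simp add: lin_comb_plus c)
    then show ?case by simp
  qed
next
  have scale: "(\<lambda>j. n * b j) \<in> mon B" if "b \<in> B" for n and b :: "'a \<Rightarrow> nat"
  proof (induct n)
    case 0
    show ?case using mon_zero[of B] by (simp add: zero_fun_def)
  next
    case (Suc n)
    from mon_add[OF that this] show ?case by (simp add: plus_fun_def)
  qed
  have "lin_comb B' c \<in> mon B" if "B' \<subseteq> B" for B' c
    using finite_subset[OF that assms] that
  proof (induct B')
    case empty
    show ?case using mon_zero[of B] by (simp add: lin_comb_def zero_fun_def)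
  next
    case (insert b B')
    have "lin_comb (insert b B') c = (\<lambda>j. c b * b j) + lin_comb B' c"
      using insert by (auto simp: lin_comb_def plus_fun_def)
    moreover have "(\<lambda>j. c b * b j) \<in> mon B" using insert scale by auto
    ultimately show ?case using insert by (metis insert_subset mon_plus)
  qed
  then show "x \<in> mon B" if "x \<in> range (lin_comb B)" for x
    using that by auto
qed

text \<open>A common point is given by two coefficient vectors, one for each set of generators,
  whose expressions agree. Such pairs solve a linear equation, and the intersection is an affine
  image of the solution set.\<close>

lemma semilin_lin_Int:
  fixes u u' :: "'i \<Rightarrow> nat"
  assumes B: "finite B" and B': "finite B'"
  shows "semilin (lin u B \<inter> lin u' B')"
proof -
  define f where "f c = lin_comb B (\<lambda>b. c (Inl b))" for c :: "('i \<Rightarrow> nat) + ('i \<Rightarrow> nat) \<Rightarrow> nat"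
  define g where "g c = lin_comb B' (\<lambda>b. c (Inr b))" for c :: "('i \<Rightarrow> nat) + ('i \<Rightarrow> nat) \<Rightarrow> nat"
  have f: "monoid_hom f" and g: "monoid_hom g"
    by (auto simp: f_def g_def lin_comb_def algebra_simps sum.distrib intro!: monoid_homI)
  define X where "X = {c \<in> supp_in (B <+> B'). u + f c = u' + g c}"
  have "semilin X"
    unfolding X_def using B B' f g by (intro semilin_solutions) auto
  then have "semilin ((\<lambda>c. u + f c) ` X)"
    using f by (rule semilin_affine_image)
  also have "(\<lambda>c. u + f c) ` X = lin u B \<inter> lin u' B'"
  proof (intro equalityI subsetI)
    fix x assume "x \<in> (\<lambda>c. u + f c) ` X"
    then obtain c where "c \<in> X" "x = u + f c" by auto
    then have "x = u + f c" "x = u' + g c" by (auto simp: X_def)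
    then show "x \<in> lin u B \<inter> lin u' B'"
      unfolding lin_def mon_conv_lin_comb[OF B] mon_conv_lin_comb[OF B'] f_def g_def
      by (metis IntI imageI rangeI)
  next
    fix x assume "x \<in> lin u B \<inter> lin u' B'"
    then obtain c c' where c: "x = u + lin_comb B c" "x = u' + lin_comb B' c'"
      unfolding lin_def mon_conv_lin_comb[OF B] mon_conv_lin_comb[OF B'] by (elim IntE imageE) blast
    \<comment> \<open>The coefficients are cut off outside \<open>B\<close> and \<open>B'\<close> to
      obtain finite support; the two sums do not change.\<close>
    define e where "e = case_sum (\<lambda>b. if b \<in> B then c b else 0) (\<lambda>b. if b \<in> B' then c' b else 0)"
    have "f e = lin_comb B c" "g e = lin_comb B' c'"
      by (auto simp: f_def g_def e_def lin_comb_def)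
    moreover have "e \<in> supp_in (B <+> B')"
      by (auto simp: supp_in_def e_def split: sum.splits)
    ultimately show "x \<in> (\<lambda>c. u + f c) ` X"
      using c by (intro image_eqI[of _ _ e]) (auto simp: X_def)
  qed
  finally show ?thesis .
qed

lemma semilin_Int:
  fixes S S' :: "('i \<Rightarrow> nat) set"
  assumes "semilin S" "semilin S'"
  shows "semilin (S \<inter> S')"
proof -
  obtain P P' where P: "finite P" "\<forall>(u, B) \<in> P. finite B" "S = (\<Union>(u, B)\<in>P. lin u B)"
    "finite P'" "\<forall>(u, B) \<in> P'. finite B" "S' = (\<Union>(u, B)\<in>P'. lin u B)"
    using assms unfolding semilin_def by blast
  have "S \<inter> S' = (\<Union>(u, B)\<in>P. \<Union>(u', B')\<in>P'. lin u B \<inter> lin u' B')"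
    unfolding P by auto
  also have "semilin \<dots>"
    using P by (intro semilin_UN) (auto intro!: semilin_UN semilin_lin_Int)
  finally show ?thesis .
qed


section \<open>Presburger definable sets are semilinear\<close>

lemma Inum_affine:
  fixes k :: nat
  shows "\<exists>c a. \<forall>x :: nat \<Rightarrow> nat. Inum (map (\<lambda>i. int (x i)) [0..<k]) t = c + (\<Sum>i<k. a i * int (x i))"
proof -
  have nth: "\<exists>c a. \<forall>x :: nat \<Rightarrow> nat. map (\<lambda>i. int (x i)) [0..<k] ! n = c + (\<Sum>i<k. a i * int (x i))" for n
  proof (cases "n < k")
    case True
    have "(\<Sum>i<k. (if i = n then 1 else 0) * int (x i)) = int (x n)" for x :: "nat \<Rightarrow> nat"
    proof -
      have "(\<Sum>i<k. (if i = n then 1 else 0) * int (x i)) = (\<Sum>i<k. if i = n then int (x i) else 0)"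
        by (rule sum.cong) auto
      then show ?thesis using True by simp
    qed
    then show ?thesis using True by (intro exI[of _ 0] exI[of _ "\<lambda>i. if i = n then 1 else 0"]) simp
  next
    case False
    \<comment> \<open>An index past the end of the list yields \<open>[] ! (n - k)\<close>, which is
      unspecified but the same for all \<open>x\<close>, hence a constant term.\<close>
    have "map (\<lambda>i. int (x i)) [0..<k] ! n = [] ! (n - k)" for x :: "nat \<Rightarrow> nat"
      using False nth_append[of "map (\<lambda>i. int (x i)) [0..<k]" "[]" n] by simp
    then show ?thesis by (intro exI[of _ "[] ! (n - k)"] exI[of _ "\<lambda>_. 0"]) simp
  qed
  show ?thesis
  proof (induct t)
    case (C c)
    show ?case by (intro exI[of _ c] exI[of _ "\<lambda>_. 0"]) simp
  next
    case (Bound n)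
    show ?case using nth[of n] by simp
  next
    case (CN n m t)
    obtain c a c' a' where
      *: "\<And>x :: nat \<Rightarrow> nat. map (\<lambda>i. int (x i)) [0..<k] ! n = c + (\<Sum>i<k. a i * int (x i))"
      "\<And>x :: nat \<Rightarrow> nat. Inum (map (\<lambda>i. int (x i)) [0..<k]) t = c' + (\<Sum>i<k. a' i * int (x i))"
      using nth[of n] CN by blast
    show ?case
      by (intro exI[of _ "m * c + c'"] exI[of _ "\<lambda>i. m * a i + a' i"])
        (simp add: * algebra_simps sum.distrib sum_distrib_left)
  next
    case (Neg t)
    then obtain c a where
      *: "\<And>x :: nat \<Rightarrow> nat. Inum (map (\<lambda>i. int (x i)) [0..<k]) t = c + (\<Sum>i<k. a i * int (x i))"
      by blast
    show ?case
      by (intro exI[of _ "- c"] exI[of _ "\<lambda>i. - a i"]) (simp add: * sum_negf)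
  next
    case (Add s t)
    then obtain c a c' a' where
      *: "\<And>x :: nat \<Rightarrow> nat. Inum (map (\<lambda>i. int (x i)) [0..<k]) s = c + (\<Sum>i<k. a i * int (x i))"
      "\<And>x :: nat \<Rightarrow> nat. Inum (map (\<lambda>i. int (x i)) [0..<k]) t = c' + (\<Sum>i<k. a' i * int (x i))"
      by blast
    show ?case
      by (intro exI[of _ "c + c'"] exI[of _ "\<lambda>i. a i + a' i"])
        (simp add: * algebra_simps sum.distrib)
  next
    case (Sub s t)
    then obtain c a c' a' where
      *: "\<And>x :: nat \<Rightarrow> nat. Inum (map (\<lambda>i. int (x i)) [0..<k]) s = c + (\<Sum>i<k. a i * int (x i))"
      "\<And>x :: nat \<Rightarrow> nat. Inum (map (\<lambda>i. int (x i)) [0..<k]) t = c' + (\<Sum>i<k. a' i * int (x i))"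
      by blast
    show ?case
      by (intro exI[of _ "c - c'"] exI[of _ "\<lambda>i. a i - a' i"])
        (simp add: * algebra_simps sum_subtractf)
  next
    case (Mul m t)
    then obtain c a where
      *: "\<And>x :: nat \<Rightarrow> nat. Inum (map (\<lambda>i. int (x i)) [0..<k]) t = c + (\<Sum>i<k. a i * int (x i))"
      by blast
    show ?case
      by (intro exI[of _ "m * c"] exI[of _ "\<lambda>i. m * a i"])
        (simp add: * algebra_simps sum_distrib_left)
  qed
qed

text \<open>With the two slack variables \<open>p\<close> and \<open>q\<close> this covers equations, inequalities and
  divisibilities.\<close>

lemma semilin_slack_equation:
  fixes s s' c :: int and k :: nat
  shows "semilin {x \<in> supp_in {..<k}. \<exists>p q :: nat. c + (\<Sum>i<k. a i * int (x i)) + s * int p + s' * int q = 0}"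
    (is "semilin ?S")
proof -
  \<comment> \<open>The slack variables become the coordinates \<open>k\<close> and
    \<open>Suc k\<close>, which \<open>g\<close> projects away afterwards.\<close>
  define f where "f y = (\<Sum>i<k. a i * int (y i)) + s * int (y k) + s' * int (y (Suc k))" for y :: "nat \<Rightarrow> nat"
  define g :: "(nat \<Rightarrow> nat) \<Rightarrow> nat \<Rightarrow> nat" where "g y = (\<lambda>i. if i < k then y i else 0)" for y
  have f: "monoid_hom f" and g: "monoid_hom g"
    by (auto simp: f_def g_def algebra_simps sum.distrib intro!: monoid_homI)
  have 0: "monoid_hom (\<lambda>_ :: nat \<Rightarrow> nat. 0 :: int)"
    by (simp add: monoid_hom_def)
  let ?Y = "{y \<in> supp_in {..<Suc (Suc k)}. c + f y = 0 + 0}"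
  have "semilin (g ` ?Y)"
    using f 0 g by (intro semilin_hom_image semilin_solutions) auto
  also have "g ` ?Y = ?S"
  proof (intro equalityI subsetI)
    fix x assume "x \<in> g ` ?Y"
    then obtain y where "c + f y = 0" "x = g y" by auto
    then have "c + (\<Sum>i<k. a i * int (x i)) + s * int (y k) + s' * int (y (Suc k)) = 0" "x \<in> supp_in {..<k}"
      by (auto simp: f_def g_def supp_in_def add.assoc)
    then show "x \<in> ?S" by blast
  next
    fix x assume "x \<in> ?S"
    then obtain p q where x: "x \<in> supp_in {..<k}"
      "c + (\<Sum>i<k. a i * int (x i)) + s * int p + s' * int q = 0" by blast
    define y where "y = x(k := p, Suc k := q)"
    have "g y = x" "y \<in> supp_in {..<Suc (Suc k)}" "c + f y = 0"
      using x by (auto simp: g_def y_def f_def supp_in_def add.assoc)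
    then show "x \<in> g ` ?Y" by force
  qed
  finally show ?thesis .
qed

lemma int_as_diff: "\<exists>p q. z = int p - int q"
  by (metis int_diff_cases)

text \<open>An equation takes no slack, an inequality one natural number for the difference of its
  sides, and a divisibility two, since its cofactor is an integer of either sign and is written as a
  difference of naturals.\<close>

lemma semilin_atoms:
  fixes k :: nat and c :: int and a :: "nat \<Rightarrow> int"
  defines "t \<equiv> \<lambda>x :: nat \<Rightarrow> nat. c + (\<Sum>i<k. a i * int (x i))"
  shows "semilin {x \<in> supp_in {..<k}. t x = 0}"
    and "semilin {x \<in> supp_in {..<k}. t x \<ge> b}"
    and "semilin {x \<in> supp_in {..<k}. t x \<le> b}"
    and "semilin {x \<in> supp_in {..<k}. d dvd t x + b}"
proof -
  show "semilin {x \<in> supp_in {..<k}. t x = 0}"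
    using semilin_slack_equation[where k = k and c = c and a = a and s = 0 and s' = 0] unfolding t_def by simp
  have "t x \<ge> b \<longleftrightarrow> (\<exists>p q :: nat. (c - b) + (\<Sum>i<k. a i * int (x i)) + (- 1) * int p + 0 * int q = 0)" for x
    unfolding t_def by (auto intro!: exI[of _ "nat (t x - b)"] simp: t_def)
  then show "semilin {x \<in> supp_in {..<k}. t x \<ge> b}"
    using semilin_slack_equation[where k = k and c = "c - b" and a = a and s = "- 1" and s' = 0] by simp
  have "t x \<le> b \<longleftrightarrow> (\<exists>p q :: nat. (c - b) + (\<Sum>i<k. a i * int (x i)) + 1 * int p + 0 * int q = 0)" for x
    unfolding t_def by (auto intro!: exI[of _ "nat (b - t x)"] simp: t_def)
  then show "semilin {x \<in> supp_in {..<k}. t x \<le> b}"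
    using semilin_slack_equation[where k = k and c = "c - b" and a = a and s = 1 and s' = 0] by simp
  have "d dvd t x + b \<longleftrightarrow> (\<exists>p q :: nat. (c + b) + (\<Sum>i<k. a i * int (x i)) + d * int p + (- d) * int q = 0)" for x
  proof
    assume "d dvd t x + b"
    then obtain z where z: "t x + b = d * z" by (auto simp: dvd_def)
    obtain p q where "- z = int p - int q" using int_as_diff by blast
    then have "t x + b + d * int p + (- d) * int q = 0"
    proof -
      have "d * z + d * (int p - int q) = d * (z - z)"
        unfolding \<open>- z = int p - int q\<close>[symmetric] by simp
      then show ?thesis using z by (simp add: algebra_simps)
    qed
    then have "(c + b) + (\<Sum>i<k. a i * int (x i)) + d * int p + (- d) * int q = 0"
      unfolding t_def by simp
    then show "\<exists>p q :: nat. (c + b) + (\<Sum>i<k. a i * int (x i)) + d * int p + (- d) * int q = 0" by blast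
  next
    assume "\<exists>p q :: nat. (c + b) + (\<Sum>i<k. a i * int (x i)) + d * int p + (- d) * int q = 0"
    then obtain p q :: nat where "t x + b = d * (int q - int p)"
      unfolding t_def by (auto simp: algebra_simps)
    then show "d dvd t x + b" by simp
  qed
  then show "semilin {x \<in> supp_in {..<k}. d dvd t x + b}"
    using semilin_slack_equation[where k = k and c = "c + b" and a = a and s = d and s' = "- d"] by simp
qed

section \<open>Boolean combinations of atoms\<close>

lemma semilin_Collect_disj:
  assumes "semilin {x \<in> V. P x}" "semilin {x \<in> V. Q x}"
  shows "semilin {x \<in> V. P x \<or> Q x}"
proof -
  have "{x \<in> V. P x \<or> Q x} = {x \<in> V. P x} \<union> {x \<in> V. Q x}" by auto
  then show ?thesis using semilin_Un[OF assms] by simp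
qed

lemma semilin_Collect_conj:
  assumes "semilin {x \<in> V. P x}" "semilin {x \<in> V. Q (x :: 'i \<Rightarrow> nat)}"
  shows "semilin {x \<in> V. P x \<and> Q x}"
proof -
  have "{x \<in> V. P x \<and> Q x} = {x \<in> V. P x} \<inter> {x \<in> V. Q x}" by auto
  then show ?thesis using semilin_Int[OF assms] by simp
qed

lemma semilin_neq:
  fixes k :: nat and c :: int and a :: "nat \<Rightarrow> int"
  defines "t \<equiv> \<lambda>x :: nat \<Rightarrow> nat. c + (\<Sum>i<k. a i * int (x i))"
  shows "semilin {x \<in> supp_in {..<k}. t x \<noteq> 0}"
proof -
  have "t x \<noteq> 0 \<longleftrightarrow> t x \<le> - 1 \<or> t x \<ge> 1" for x by linarith
  then show ?thesis
    using semilin_Collect_disj[OF semilin_atoms(3)[where k = k and c = c and a = a and b = "- 1"] semilin_atoms(2)[where k = k and c = c and a = a and b = 1]]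
    unfolding t_def by simp
qed

text \<open>For \<open>d \<noteq> 0\<close> non-divisibility means one of finitely many nonzero
  residues; \<open>d = 0\<close> divides only 0, which leaves a disequation.\<close>

lemma semilin_not_dvd:
  fixes k :: nat and c :: int and a :: "nat \<Rightarrow> int"
  defines "t \<equiv> \<lambda>x :: nat \<Rightarrow> nat. c + (\<Sum>i<k. a i * int (x i))"
  shows "semilin {x \<in> supp_in {..<k}. \<not> d dvd t x}"
proof (cases "d = 0")
  case True
  then show ?thesis using semilin_neq[where k = k and c = c and a = a] unfolding t_def by simp
next
  case False
  have *: "\<not> d dvd z \<longleftrightarrow> (\<exists>r\<in>{1..<\<bar>d\<bar>}. d dvd z + r)" for z
  proof
    assume "\<not> d dvd z"
    then have "z mod \<bar>d\<bar> \<noteq> 0" by (simp add: mod_eq_0_iff_dvd)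
    moreover have "0 \<le> z mod \<bar>d\<bar>" "z mod \<bar>d\<bar> < \<bar>d\<bar>" using False by simp_all
    \<comment> \<open>The witness is what \<open>z\<close> lacks to the next multiple of
      \<open>\<bar>d\<bar>\<close>.\<close>
    moreover have "d dvd z + (\<bar>d\<bar> - z mod \<bar>d\<bar>)"
    proof -
      have "z + (\<bar>d\<bar> - z mod \<bar>d\<bar>) = \<bar>d\<bar> * (z div \<bar>d\<bar>) + \<bar>d\<bar>"
        using mult_div_mod_eq[of "\<bar>d\<bar>" z] by linarith
      then show ?thesis by (metis abs_dvd_iff dvd_add dvd_triv_left dvd_refl)
    qed
    ultimately show "\<exists>r\<in>{1..<\<bar>d\<bar>}. d dvd z + r"
      by (intro bexI[of _ "\<bar>d\<bar> - z mod \<bar>d\<bar>"]) auto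
  next
    assume "\<exists>r\<in>{1..<\<bar>d\<bar>}. d dvd z + r"
    then obtain r where r: "1 \<le> r" "r < \<bar>d\<bar>" "d dvd z + r" by auto
    show "\<not> d dvd z"
    proof
      assume "d dvd z"
      then have "d dvd r" using r(3) by (simp add: dvd_add_right_iff)
      then show False using r zdvd_not_zless[of r "\<bar>d\<bar>"] by simp
    qed
  qed
  have "{x \<in> supp_in {..<k}. \<not> d dvd t x} = (\<Union>r\<in>{1..<\<bar>d\<bar>}. {x \<in> supp_in {..<k}. d dvd t x + r})"
    unfolding * by auto
  also have "semilin \<dots>"
    unfolding t_def by (intro semilin_UN semilin_atoms) auto
  finally show ?thesis .
qed

lemma semilin_supp_in: "semilin (supp_in {..<k :: nat})"
  using semilin_atoms(1)[where k = k and c = 0 and a = "\<lambda>_. 0"] by simp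

text \<open>The formula and its negation are handled in one induction, which pushes negations down
  to the atoms; so unions and intersections suffice and no complement of a semilinear set is
  formed.\<close>

lemma semilin_qfree:
  fixes k :: nat
  defines "env \<equiv> \<lambda>x :: nat \<Rightarrow> nat. map (\<lambda>i. int (x i)) [0..<k]"
  assumes "qfree p"
  shows "semilin {x \<in> supp_in {..<k}. Ifm bbs (env x) p} \<and>
    semilin {x \<in> supp_in {..<k}. \<not> Ifm bbs (env x) p}"
proof -
  have less: "z < 0 \<longleftrightarrow> z \<le> - 1" "0 < z \<longleftrightarrow> 1 \<le> z" for z :: int by linarith+
  have atoms: "semilin {x \<in> supp_in {..<k}. Inum (env x) t = 0}"
    "semilin {x \<in> supp_in {..<k}. Inum (env x) t \<noteq> 0}"
    "semilin {x \<in> supp_in {..<k}. Inum (env x) t \<le> 0}"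
    "semilin {x \<in> supp_in {..<k}. 0 \<le> Inum (env x) t}"
    "semilin {x \<in> supp_in {..<k}. Inum (env x) t < 0}"
    "semilin {x \<in> supp_in {..<k}. 0 < Inum (env x) t}"
    "semilin {x \<in> supp_in {..<k}. d dvd Inum (env x) t}"
    "semilin {x \<in> supp_in {..<k}. \<not> d dvd Inum (env x) t}" for t d
  proof -
    obtain c a where *: "\<And>x. Inum (env x) t = c + (\<Sum>i<k. a i * int (x i))"
      unfolding env_def using Inum_affine[of k t] by blast
    show "semilin {x \<in> supp_in {..<k}. Inum (env x) t = 0}"
      "semilin {x \<in> supp_in {..<k}. Inum (env x) t \<noteq> 0}"
      "semilin {x \<in> supp_in {..<k}. Inum (env x) t \<le> 0}"
      "semilin {x \<in> supp_in {..<k}. 0 \<le> Inum (env x) t}"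
      "semilin {x \<in> supp_in {..<k}. Inum (env x) t < 0}"
      "semilin {x \<in> supp_in {..<k}. 0 < Inum (env x) t}"
      "semilin {x \<in> supp_in {..<k}. d dvd Inum (env x) t}"
      "semilin {x \<in> supp_in {..<k}. \<not> d dvd Inum (env x) t}"
      unfolding * less
      using semilin_atoms(4)[where k = k and d = d and c = c and a = a and b = 0]
      by (simp_all only: add_0_right semilin_atoms semilin_neq semilin_not_dvd)
  qed
  define S where "S P \<longleftrightarrow> semilin {x \<in> supp_in {..<k}. P x}" for P
  have disj: "S (\<lambda>x. P x \<or> Q x)" and conj: "S (\<lambda>x. P x \<and> Q x)" if "S P" "S Q" for P Q
    using that unfolding S_def by (rule semilin_Collect_disj, rule semilin_Collect_conj)
  \<comment> \<open>Besides truth and falsity this covers the propositional atoms, which are read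
    off \<open>bbs\<close> and do not depend on \<open>x\<close>.\<close>
  have const: "S (\<lambda>_. b)" for b
    by (cases b) (simp_all add: S_def semilin_supp_in)
  have "S (\<lambda>x. Ifm bbs (env x) p) \<and> S (\<lambda>x. \<not> Ifm bbs (env x) p)"
    using assms(2)
  proof (induct p)
    case (And p q)
    then show ?case by (simp only: Ifm.simps qfree.simps de_Morgan_conj de_Morgan_disj conj disj simp_thms)
  next
    case (Or p q)
    then show ?case by (simp only: Ifm.simps qfree.simps de_Morgan_conj de_Morgan_disj conj disj simp_thms)
  next
    case (Imp p q)
    then show ?case by (simp only: Ifm.simps qfree.simps imp_conv_disj de_Morgan_disj not_not conj disj simp_thms)
  next
    case (Iff p q)
    have "(\<lambda>x. Ifm bbs (env x) (Iff p q)) =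
        (\<lambda>x. (Ifm bbs (env x) p \<and> Ifm bbs (env x) q) \<or> (\<not> Ifm bbs (env x) p \<and> \<not> Ifm bbs (env x) q))"
      "(\<lambda>x. \<not> Ifm bbs (env x) (Iff p q)) =
        (\<lambda>x. (Ifm bbs (env x) p \<and> \<not> Ifm bbs (env x) q) \<or> (\<not> Ifm bbs (env x) p \<and> Ifm bbs (env x) q))"
      by auto
    then show ?case using Iff by (simp only: qfree.simps conj disj simp_thms)
  qed (simp_all add: const, simp_all add: S_def atoms not_less not_le)
  then show ?thesis unfolding S_def .
qed


section \<open>Translation into integer formulas with de Bruijn indices\<close>

primrec trans_tm :: "(nat \<Rightarrow> nat) \<Rightarrow> tm \<Rightarrow> num" where
  "trans_tm \<sigma> (Var x) = Bound (\<sigma> x)"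
| "trans_tm \<sigma> (Plus s t) = Add (trans_tm \<sigma> s) (trans_tm \<sigma> t)"

text \<open>Quantifiers over the naturals become integer quantifiers guarded by
  \<open>Ge (Bound 0)\<close>, that is, by nonnegativity. The map \<open>\<sigma>\<close> sends
  variables to indices; under a binder all indices are shifted and \<open>x\<close> gets index 0,
  which also takes care of shadowing.\<close>

primrec trans_fm :: "(nat \<Rightarrow> nat) \<Rightarrow> Defs.fm \<Rightarrow> Cooper.fm" where
  "trans_fm \<sigma> (Defs.Eq s t) = Cooper.Eq (Sub (trans_tm \<sigma> s) (trans_tm \<sigma> t))"
| "trans_fm \<sigma> (Defs.Neg \<phi>) = Cooper.Not (trans_fm \<sigma> \<phi>)"
| "trans_fm \<sigma> (Conj \<phi> \<psi>) = And (trans_fm \<sigma> \<phi>) (trans_fm \<sigma> \<psi>)"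
| "trans_fm \<sigma> (Disj \<phi> \<psi>) = Or (trans_fm \<sigma> \<phi>) (trans_fm \<sigma> \<psi>)"
| "trans_fm \<sigma> (Defs.Ex x \<phi>) = Cooper.E (And (Ge (Bound 0)) (trans_fm ((\<lambda>y. Suc (\<sigma> y))(x := 0)) \<phi>))"
| "trans_fm \<sigma> (Defs.All x \<phi>) = Cooper.A (Imp (Ge (Bound 0)) (trans_fm ((\<lambda>y. Suc (\<sigma> y))(x := 0)) \<phi>))"

lemma Inum_trans_tm:
  "(\<And>y. y \<in> fv_tm t \<Longrightarrow> bs ! \<sigma> y = int (e y)) \<Longrightarrow> Inum bs (trans_tm \<sigma> t) = int (eval_tm e t)"
  by (induct t) auto

lemma Ifm_trans_fm:
  "(\<And>y. y \<in> fv \<phi> \<Longrightarrow> bs ! \<sigma> y = int (e y)) \<Longrightarrow> Ifm bbs bs (trans_fm \<sigma> \<phi>) \<longleftrightarrow> sat e \<phi>"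
proof (induct \<phi> arbitrary: bs \<sigma> e)
  case (Eq s t)
  then have "Inum bs (trans_tm \<sigma> s) = int (eval_tm e s)" "Inum bs (trans_tm \<sigma> t) = int (eval_tm e t)"
    by (auto intro!: Inum_trans_tm)
  then show ?case by simp
next
  case (Conj \<phi> \<psi>)
  from Conj.hyps(1)[of bs \<sigma> e] Conj.hyps(2)[of bs \<sigma> e] show ?case using Conj.prems by simp
next
  case (Disj \<phi> \<psi>)
  from Disj.hyps(1)[of bs \<sigma> e] Disj.hyps(2)[of bs \<sigma> e] show ?case using Disj.prems by simp
next
  case (Ex x \<phi>)
  have "Ifm bbs (int v # bs) (trans_fm ((\<lambda>y. Suc (\<sigma> y))(x := 0)) \<phi>) \<longleftrightarrow> sat (e(x := v)) \<phi>" for v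
    using Ex.prems by (intro Ex.hyps) auto
  then show ?case by simp (metis nonneg_int_cases of_nat_0_le_iff)
next
  case (All x \<phi>)
  have "Ifm bbs (int v # bs) (trans_fm ((\<lambda>y. Suc (\<sigma> y))(x := 0)) \<phi>) \<longleftrightarrow> sat (e(x := v)) \<phi>" for v
    using All.prems by (intro All.hyps) auto
  then show ?case by simp (metis nonneg_int_cases of_nat_0_le_iff)
qed auto

text \<open>Cooper's procedure \<open>pa\<close> yields an equivalent quantifier-free formula. The
  map \<open>\<sigma>\<close> selects the coordinate that each variable reads, so that one formula
  can be evaluated at different blocks of a longer tuple.\<close>

lemma semilin_definable:
  fixes k :: nat
  assumes "\<And>y. y \<in> fv \<phi> \<Longrightarrow> \<sigma> y < k"
  shows "semilin {x \<in> supp_in {..<k}. sat (\<lambda>y. x (\<sigma> y)) \<phi>}"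
proof -
  have "Ifm [] (map (\<lambda>i. int (x i)) [0..<k]) (pa (trans_fm \<sigma> \<phi>)) \<longleftrightarrow> sat (\<lambda>y. x (\<sigma> y)) \<phi>" for x
    unfolding conjunct1[OF mirqe] using assms by (intro Ifm_trans_fm) simp
  moreover have "qfree (pa (trans_fm \<sigma> \<phi>))" using mirqe by blast
  ultimately show ?thesis
    using semilin_qfree[of "pa (trans_fm \<sigma> \<phi>)" k "[]"] by simp
qed

lemma eval_tm_cong: "(\<And>y. y \<in> fv_tm t \<Longrightarrow> e y = e' y) \<Longrightarrow> eval_tm e t = eval_tm e' t"
  by (induct t) auto

lemma sat_cong:
  "(\<And>y. y \<in> fv \<phi> \<Longrightarrow> e y = e' y) \<Longrightarrow> sat e \<phi> \<longleftrightarrow> sat e' \<phi>"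
proof (induct \<phi> arbitrary: e e')
  case (Eq s t)
  then have "eval_tm e s = eval_tm e' s" "eval_tm e t = eval_tm e' t"
    by (auto intro!: eval_tm_cong)
  then show ?case by simp
next
  case (Neg \<phi>)
  from Neg.hyps[of e e'] show ?case using Neg.prems by simp
next
  case (Conj \<phi> \<psi>)
  from Conj.hyps(1)[of e e'] Conj.hyps(2)[of e e'] show ?case using Conj.prems by simp
next
  case (Disj \<phi> \<psi>)
  from Disj.hyps(1)[of e e'] Disj.hyps(2)[of e e'] show ?case using Disj.prems by simp
next
  case (Ex x \<phi>)
  have "sat (e(x := v)) \<phi> \<longleftrightarrow> sat (e'(x := v)) \<phi>" for v
    using Ex.prems by (intro Ex.hyps) auto
  then show ?case by simp
next
  case (All x \<phi>)
  have "sat (e(x := v)) \<phi> \<longleftrightarrow> sat (e'(x := v)) \<phi>" for v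
    using All.prems by (intro All.hyps) auto
  then show ?case by simp
qed


section \<open>Growth of semilinear sets\<close>

definition box_card :: "nat \<Rightarrow> (nat \<Rightarrow> nat) set \<Rightarrow> nat \<Rightarrow> nat" where
  "box_card m S n = card {x \<in> S. \<forall>i<m. x i \<le> n}"

text \<open>The coordinates below \<open>m\<close> form the point that is counted, those from
  \<open>m\<close> on hold the parameters, which \<open>p\<close> fixes. Members of the fibre keep
  their parameter coordinates.\<close>

definition fibre :: "nat \<Rightarrow> (nat \<Rightarrow> nat) \<Rightarrow> (nat \<Rightarrow> nat) set \<Rightarrow> (nat \<Rightarrow> nat) set" where
  "fibre m p Z = {z \<in> Z. \<forall>i\<ge>m. z i = p i}"

text \<open>Ensures that \<open>box_card\<close> really counts, as \<open>card\<close> is 0 on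
  infinite sets.\<close>

lemma finite_box:
  fixes m :: nat
  assumes "\<And>z i. z \<in> S \<Longrightarrow> m \<le> i \<Longrightarrow> z i = p i"
  shows "finite {z \<in> S. \<forall>i<m. z i \<le> (n :: nat)}"
proof -
  let ?F = "{f. \<forall>i. (i \<in> {..<m} \<longrightarrow> f i \<in> {..n}) \<and> (i \<notin> {..<m} \<longrightarrow> f i = (0 :: nat))}"
  have "finite ?F" by (rule finite_set_of_finite_funs) auto
  moreover have "{z \<in> S. \<forall>i<m. z i \<le> n} \<subseteq> (\<lambda>f i. if i < m then f i else p i) ` ?F"
  proof
    fix z assume z: "z \<in> {z \<in> S. \<forall>i<m. z i \<le> n}"
    show "z \<in> (\<lambda>f i. if i < m then f i else p i) ` ?F"
      by (rule image_eqI[of _ _ "\<lambda>i. if i < m then z i else 0"]) (use z assms in auto)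
  qed
  ultimately show ?thesis by (rule finite_surj)
qed

section \<open>Growth of finitely generated monoids of tuples\<close>

lemma mon_supp_in:
  assumes "B \<subseteq> supp_in J" "x \<in> mon B"
  shows "x \<in> supp_in J"
  using assms(2,1) by induct (auto simp: supp_in_def)

lemma finite_mon_box:
  assumes "B \<subseteq> supp_in {..<m :: nat}"
  shows "finite {x \<in> mon B. \<forall>i<m. x i \<le> n}"
  by (rule finite_box[where p = "\<lambda>_. 0"]) (use mon_supp_in[OF assms] in \<open>auto simp: supp_in_def\<close>)

text \<open>For finite \<open>B\<close> this is linear independence over the rationals; a relation
  is stated as an equality of two combinations with natural coefficients, to avoid
  subtraction.\<close>

definition indep :: "('i \<Rightarrow> nat) set \<Rightarrow> bool" where
  "indep B \<longleftrightarrow> (\<forall>c c'. lin_comb B c = lin_comb B c' \<longrightarrow> (\<forall>b\<in>B. c b = c' b))"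

text \<open>Two different combinations of \<open>insert b I\<close> with equal value must differ at
  \<open>b\<close>, as \<open>I\<close> is independent. Solving for \<open>b\<close> expresses a
  positive multiple of it by \<open>I\<close> with integer coefficients.\<close>

lemma indep_max_spans:
  assumes "finite I" "indep I" "b \<in> I \<or> \<not> indep (insert b I)"
  shows "\<exists>k z. k > 0 \<and> (\<forall>j. int k * int (b j) = (\<Sum>i\<in>I. z i * int (i j)))"
proof (cases "b \<in> I")
  case True
  have "(\<Sum>i\<in>I. (if i = b then 1 else 0) * int (i j)) = int (b j)" for j
  proof -
    have "(\<Sum>i\<in>I. (if i = b then 1 else 0) * int (i j)) = (\<Sum>i\<in>I. if i = b then int (i j) else 0)"
      by (rule sum.cong) auto
    then show ?thesis using True assms(1) by simp
  qed
  then show ?thesis by (intro exI[of _ 1] exI[of _ "\<lambda>i. if i = b then 1 else 0"]) simp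
next
  case False
  then obtain c c' where c: "lin_comb (insert b I) c = lin_comb (insert b I) c'"
    "\<not> (\<forall>i\<in>insert b I. c i = c' i)"
    using assms(3) unfolding indep_def by blast
  have eq: "c b * b j + lin_comb I c j = c' b * b j + lin_comb I c' j" for j
    using fun_cong[OF c(1), of j] False assms(1) by (simp add: lin_comb_def)
  have "c b \<noteq> c' b"
  proof
    assume "c b = c' b"
    then have "lin_comb I c = lin_comb I c'" using eq by auto
    then have "\<forall>i\<in>I. c i = c' i" using assms(2) unfolding indep_def by blast
    then show False using c(2) \<open>c b = c' b\<close> by simp
  qed
  define \<delta> where "\<delta> = int (c b) - int (c' b)"
  have "\<delta> \<noteq> 0" using \<open>c b \<noteq> c' b\<close> by (simp add: \<delta>_def)
  have \<delta>: "\<delta> * int (b j) = (\<Sum>i\<in>I. (int (c' i) - int (c i)) * int (i j))" for j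
  proof -
    have "int (c b * b j + lin_comb I c j) = int (c' b * b j + lin_comb I c' j)"
      using eq by simp
    then show ?thesis
      by (simp add: \<delta>_def lin_comb_def algebra_simps sum_subtractf)
  qed
  \<comment> \<open>Multiplication by \<open>sgn \<delta>\<close> makes the factor of
    \<open>b\<close> positive.\<close>
  have "int (nat \<bar>\<delta>\<bar>) * int (b j) = (\<Sum>i\<in>I. (sgn \<delta> * (int (c' i) - int (c i))) * int (i j))" for j
  proof -
    have "int (nat \<bar>\<delta>\<bar>) * int (b j) = sgn \<delta> * (\<delta> * int (b j))"
      by (simp add: abs_if sgn_if)
    then show ?thesis unfolding \<delta> by (simp add: sum_distrib_left mult.assoc)
  qed
  then show ?thesis
    using \<open>\<delta> \<noteq> 0\<close> by (intro exI[of _ "nat \<bar>\<delta>\<bar>"] exI[of _ "\<lambda>i. sgn \<delta> * (int (c' i) - int (c i))"]) simp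
qed

text \<open>For a common multiple \<open>N\<close> of the denominators, the \<open>N\<close>-fold of
  each element of the monoid is an integer combination of \<open>I\<close>. In the box of side
  \<open>n\<close> its coefficients are at most a constant times \<open>n\<close> in absolute value,
  and they determine the element, so that it suffices to count coefficient vectors.\<close>

lemma mon_box_upper:
  assumes B: "finite B" "B \<subseteq> supp_in {..<m}" and I: "finite I"
    and span: "\<And>b. b \<in> B \<Longrightarrow> \<exists>k z. k > 0 \<and> (\<forall>j. int k * int (b j) = (\<Sum>i\<in>I. z i * int (i j)))"
  shows "\<exists>K. \<forall>n. box_card m (mon B) n \<le> K * (n + 1) ^ card I"
proof -
  from span have "\<forall>b\<in>B. \<exists>k. \<exists>z. k > 0 \<and> (\<forall>j. int k * int (b j) = (\<Sum>i\<in>I. z i * int (i j)))" by blast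
  from bchoice[OF this] obtain k where
    "\<forall>b\<in>B. \<exists>z. k b > 0 \<and> (\<forall>j. int (k b) * int (b j) = (\<Sum>i\<in>I. z i * int (i j)))" by blast
  from bchoice[OF this] obtain z where kz: "\<And>b. b \<in> B \<Longrightarrow> k b > 0"
    "\<And>b j. b \<in> B \<Longrightarrow> int (k b) * int (b j) = (\<Sum>i\<in>I. z b i * int (i j))"
    by blast
  define N where "N = (\<Prod>b\<in>B. k b)"
  have "N > 0" using kz(1) by (simp add: N_def prod_pos)
  define y where "y b i = int (N div k b) * z b i" for b i
  have y: "int N * int (b j) = (\<Sum>i\<in>I. y b i * int (i j))" if "b \<in> B" for b j
  proof -
    have "k b dvd N" unfolding N_def using B(1) that by (rule dvd_prodI)
    then have "int N = int (N div k b) * int (k b)"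
      by (metis dvd_div_mult_self of_nat_mult)
    then have "int N * int (b j) = int (N div k b) * (int (k b) * int (b j))" by simp
    then show ?thesis unfolding kz(2)[OF that] y_def by (simp add: sum_distrib_left mult.assoc)
  qed
  define M where "M = (\<Sum>b\<in>B. \<Sum>i\<in>I. nat \<bar>y b i\<bar>)"
  \<comment> \<open>\<open>g\<close> recovers an element from the coefficients of its
    \<open>N\<close>-fold.\<close>
  define g where "g w = (\<lambda>j. nat ((\<Sum>i\<in>I. w i * int (i j)) div int N))"
    for w :: "(nat \<Rightarrow> nat) \<Rightarrow> int"
  have "box_card m (mon B) n \<le> (2 * M + 1) ^ card I * (n + 1) ^ card I" for n
  proof -
    let ?Q = "PiE I (\<lambda>_. {- int (n * M)..int (n * M)})"
    have "{x \<in> mon B. \<forall>i<m. x i \<le> n} \<subseteq> g ` ?Q"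
    proof
      fix x assume "x \<in> {x \<in> mon B. \<forall>i<m. x i \<le> n}"
      then obtain c0 where c0: "x = lin_comb B c0" and bound: "\<And>i. i < m \<Longrightarrow> x i \<le> n"
        unfolding mon_conv_lin_comb[OF B(1)] by auto
      \<comment> \<open>The coefficient of the zero vector is arbitrary in \<open>c0\<close>. Once
        it is set to 0, all coefficients are at most \<open>n\<close>, since every other generator
        has a positive entry.\<close>
      define c where "c b = (if b = 0 then 0 else c0 b)" for b
      have x: "x j = (\<Sum>b\<in>B. c b * b j)" for j
        unfolding c0 lin_comb_def by (rule sum.cong) (auto simp: c_def)
      have c_le: "c b \<le> n" if "b \<in> B" for b
      proof (cases "b = 0")
        case False
        then obtain j where j: "b j \<noteq> 0" by fastforce
        moreover have "b \<in> supp_in {..<m}" using that B(2) by blast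
        ultimately have "j < m" by (cases "j < m") (auto simp: supp_in_def)
        have "c b \<le> c b * b j" using j by simp
        also have "\<dots> \<le> x j" unfolding x using that B(1) by (intro member_le_sum) auto
        also have "\<dots> \<le> n" using bound \<open>j < m\<close> .
        finally show ?thesis .
      qed (simp add: c_def)
      define w where "w = restrict (\<lambda>i. \<Sum>b\<in>B. int (c b) * y b i) I"
      have "\<bar>w i\<bar> \<le> int (n * M)" if "i \<in> I" for i
      proof -
        have "\<bar>w i\<bar> \<le> (\<Sum>b\<in>B. \<bar>int (c b) * y b i\<bar>)" using that by (simp add: w_def sum_abs)
        also have "\<dots> \<le> (\<Sum>b\<in>B. int n * (\<Sum>i\<in>I. \<bar>y b i\<bar>))"
        proof (rule sum_mono)
          fix b assume "b \<in> B"
          have "\<bar>y b i\<bar> \<le> (\<Sum>i\<in>I. \<bar>y b i\<bar>)" using that I by (intro member_le_sum) auto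
          then show "\<bar>int (c b) * y b i\<bar> \<le> int n * (\<Sum>i\<in>I. \<bar>y b i\<bar>)"
            using c_le[OF \<open>b \<in> B\<close>] by (simp add: abs_mult mult_mono)
        qed
        also have "\<dots> = int (n * M)" by (simp add: M_def sum_distrib_left)
        finally show ?thesis .
      qed
      then have "w \<in> ?Q" by (auto simp: w_def abs_le_iff PiE_iff minus_le_iff)
      moreover have "g w = x"
      proof
        fix j
        have "(\<Sum>i\<in>I. w i * int (i j)) = (\<Sum>i\<in>I. \<Sum>b\<in>B. int (c b) * y b i * int (i j))"
          by (simp add: w_def sum_distrib_right)
        also have "\<dots> = (\<Sum>b\<in>B. \<Sum>i\<in>I. int (c b) * y b i * int (i j))"
          by (rule sum.swap)
        also have "\<dots> = (\<Sum>b\<in>B. int (c b) * (int N * int (b j)))"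
          by (intro sum.cong) (auto simp: y sum_distrib_left mult.assoc)
        also have "\<dots> = int N * int (x j)"
          by (simp add: x sum_distrib_left mult.left_commute)
        finally show "g w j = x j" using \<open>N > 0\<close> by (simp add: g_def)
      qed
      ultimately show "x \<in> g ` ?Q" by blast
    qed
    then have "box_card m (mon B) n \<le> card ?Q"
      unfolding box_card_def using I by (intro surj_card_le finite_PiE) auto
    also have "\<dots> = (2 * (n * M) + 1) ^ card I"
    proof -
      have "card {- int (n * M)..int (n * M)} = 2 * (n * M) + 1"
        unfolding card_atLeastAtMost_int by linarith
      then show ?thesis using I by (simp add: card_PiE)
    qed
    also have "\<dots> \<le> ((2 * M + 1) * (n + 1)) ^ card I"
      by (intro power_mono) (auto simp: algebra_simps)
    also have "\<dots> = (2 * M + 1) ^ card I * (n + 1) ^ card I" by (rule power_mult_distrib)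
    finally show ?thesis .
  qed
  then show ?thesis by blast
qed

text \<open>Combinations of \<open>I\<close> with coefficients below \<open>n\<close> are distinct
  by independence, and their entries are at most \<open>n\<close> times the sum of all entries of
  the generators in \<open>I\<close>.\<close>

lemma mon_box_lower:
  assumes B: "B \<subseteq> supp_in {..<m}" and I: "finite I" "I \<subseteq> B" "indep I"
    and K: "(\<Sum>b\<in>I. \<Sum>i<m. b i) \<le> K"
  shows "n ^ card I \<le> box_card m (mon B) (K * n)"
proof -
  have "n ^ card I = card (PiE I (\<lambda>_. {..<n}))"
    using I by (simp add: card_PiE)
  also have "\<dots> \<le> box_card m (mon B) (K * n)"
    unfolding box_card_def
  proof (rule card_inj_on_le)
    show "inj_on (lin_comb I) (PiE I (\<lambda>_. {..<n}))"
    proof (rule inj_onI)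
      fix c c' assume c: "c \<in> PiE I (\<lambda>_. {..<n})" "c' \<in> PiE I (\<lambda>_. {..<n})"
        and "lin_comb I c = lin_comb I c'"
      then have "\<forall>b\<in>I. c b = c' b" using I(3) by (simp add: indep_def)
      with c show "c = c'" by (intro PiE_ext) auto
    qed
    show "lin_comb I ` (PiE I (\<lambda>_. {..<n})) \<subseteq> {x \<in> mon B. \<forall>i<m. x i \<le> K * n}"
    proof safe
      fix c assume c: "c \<in> PiE I (\<lambda>_. {..<n})"
      have "lin_comb I c \<in> mon I" using mon_conv_lin_comb[OF I(1)] by auto
      then show "lin_comb I c \<in> mon B" using I(2) by (rule mon_mono)
      fix i assume "i < m"
      have "lin_comb I c i \<le> (\<Sum>b\<in>I. n * (\<Sum>i<m. b i))"
        unfolding lin_comb_def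
      proof (rule sum_mono)
        fix b assume "b \<in> I"
        have "b i \<le> (\<Sum>i<m. b i)" using \<open>i < m\<close> by (intro member_le_sum) auto
        moreover have "c b \<le> n" using c \<open>b \<in> I\<close> by (auto simp: PiE_iff intro: less_imp_le)
        ultimately show "c b * b i \<le> n * (\<Sum>i<m. b i)" by (intro mult_mono) auto
      qed
      also have "\<dots> = (\<Sum>b\<in>I. \<Sum>i<m. b i) * n" by (simp add: sum_distrib_left mult.commute)
      also have "\<dots> \<le> K * n" using K by simp
      finally show "lin_comb I c i \<le> K * n" .
    qed
    show "finite {x \<in> mon B. \<forall>i<m. x i \<le> K * n}" using B by (rule finite_mon_box)
  qed
  finally show ?thesis .
qed

text \<open>The exponent \<open>r\<close> is the rank: a maximal independent subset spans all
  generators, so both bounds hold with its size. The lower bound enlarges the box by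
  \<open>K\<close> instead of dividing \<open>n\<close>, which stays within the naturals.\<close>

lemma mon_box_growth:
  assumes B: "finite B" "B \<subseteq> supp_in {..<m}"
  shows "\<exists>r K. \<forall>n. box_card m (mon B) n \<le> K * (n + 1) ^ r \<and> n ^ r \<le> box_card m (mon B) (K * n)"
proof -
  have "indep {}" by (simp add: indep_def)
  then have "finite {I. I \<subseteq> B \<and> indep I}" "{I. I \<subseteq> B \<and> indep I} \<noteq> {}" using B(1) by auto
  then have "\<exists>I\<in>{I. I \<subseteq> B \<and> indep I}. \<forall>I'\<in>{I. I \<subseteq> B \<and> indep I}. I \<subseteq> I' \<longrightarrow> I = I'"
    by (rule finite_has_maximal)
  then obtain I where I: "I \<subseteq> B" "indep I" and max: "\<And>I'. I' \<subseteq> B \<Longrightarrow> indep I' \<Longrightarrow> I \<subseteq> I' \<Longrightarrow> I = I'"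
    by auto
  have fin: "finite I" using I(1) B(1) by (rule finite_subset)
  have "\<exists>k z. k > 0 \<and> (\<forall>j. int k * int (b j) = (\<Sum>i\<in>I. z i * int (i j)))" if "b \<in> B" for b
    using max[of "insert b I"] that I by (intro indep_max_spans fin I) auto
  then obtain K where K: "\<And>n. box_card m (mon B) n \<le> K * (n + 1) ^ card I"
    using mon_box_upper[OF B fin] by blast
  define K' where "K' = K + (\<Sum>b\<in>I. \<Sum>i<m. b i)"
  have "box_card m (mon B) n \<le> K' * (n + 1) ^ card I" for n
    using K[of n] by (rule order_trans) (simp add: K'_def)
  moreover have "n ^ card I \<le> box_card m (mon B) (K' * n)" for n
    using B(2) fin I by (rule mon_box_lower) (simp add: K'_def)
  ultimately show ?thesis by blast
qed

section \<open>Growth of translates and fibres\<close>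

lemma box_card_lin_upper:
  assumes "B \<subseteq> supp_in {..<m}"
  shows "box_card m (lin v B) n \<le> box_card m (mon B) n"
  unfolding box_card_def
proof (rule surj_card_le)
  show "finite {x \<in> mon B. \<forall>i<m. x i \<le> n}" using assms by (rule finite_mon_box)
  show "{x \<in> lin v B. \<forall>i<m. x i \<le> n} \<subseteq> (+) v ` {x \<in> mon B. \<forall>i<m. x i \<le> n}"
    by (fastforce simp: lin_def)
qed

lemma finite_lin_box:
  assumes "B \<subseteq> supp_in {..<m :: nat}"
  shows "finite {x \<in> lin v B. \<forall>i<m. x i \<le> n}"
  by (rule finite_box[where p = v]) (use mon_supp_in[OF assms] in \<open>auto simp: supp_in_def lin_def\<close>)

lemma box_card_lin_lower:
  assumes "B \<subseteq> supp_in {..<m}"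
  shows "box_card m (mon B) n \<le> box_card m (lin v B) ((\<Sum>i<m. v i) + n)"
  unfolding box_card_def
proof (rule card_inj_on_le)
  show "inj_on ((+) v) {x \<in> mon B. \<forall>i<m. x i \<le> n}" by (simp add: inj_on_def)
  show "finite {x \<in> lin v B. \<forall>i<m. x i \<le> (\<Sum>i<m. v i) + n}" using assms by (rule finite_lin_box)
  have "v i \<le> (\<Sum>i<m. v i)" if "i < m" for i using that by (intro member_le_sum) auto
  then show "(+) v ` {x \<in> mon B. \<forall>i<m. x i \<le> n} \<subseteq> {x \<in> lin v B. \<forall>i<m. x i \<le> (\<Sum>i<m. v i) + n}"
    by (auto simp: lin_def intro!: add_mono)
qed

text \<open>The fibres of a linear set are finite unions of translates of one and the same monoid: the
  generators are nonnegative, so those with a nonzero parameter part occur only a bounded number of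
  times above a given parameter.\<close>

lemma fibre_lin:
  assumes B: "finite B"
  shows "\<exists>W. finite W \<and> fibre m p (lin u B) = (\<Union>w\<in>W. lin w (B \<inter> supp_in {..<m}))"
proof -
  let ?B0 = "B \<inter> supp_in {..<m}" and ?B1 = "B - supp_in {..<m}"
  \<comment> \<open>\<open>W\<close> collects the sums of parameter-changing generators that lead
    from \<open>u\<close> exactly to the parameter \<open>p\<close>.\<close>
  define W where "W = {w \<in> mon ?B1. \<forall>i\<ge>m. u i + w i = p i}"
  have "\<forall>b\<in>?B1. \<exists>i\<ge>m. b i \<noteq> 0" by (auto simp: supp_in_def)
  \<comment> \<open>\<open>j b\<close> is a parameter coordinate in which \<open>b\<close> is
    positive, so \<open>p (j b)\<close> bounds the coefficient of \<open>b\<close>; the sum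
    \<open>s\<close> bounds all of them.\<close>
  then obtain j where j: "\<And>b. b \<in> ?B1 \<Longrightarrow> m \<le> j b \<and> b (j b) \<noteq> 0" by metis
  define s where "s = (\<Sum>b\<in>?B1. p (j b))"
  let ?C = "{c. \<forall>b. (b \<in> ?B1 \<longrightarrow> c b \<in> {..s}) \<and> (b \<notin> ?B1 \<longrightarrow> c b = (0 :: nat))}"
  have "finite ?C" using B by (intro finite_set_of_finite_funs) auto
  moreover have "W \<subseteq> lin_comb ?B1 ` ?C"
  proof
    fix w assume w: "w \<in> W"
    then obtain c where c: "w = lin_comb ?B1 c"
      using mon_conv_lin_comb[of ?B1] B by (auto simp: W_def)
    let ?c = "\<lambda>b. if b \<in> ?B1 then c b else 0"
    have "w = lin_comb ?B1 ?c" unfolding c lin_comb_def by (auto intro!: sum.cong)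
    moreover have "c b \<le> s" if "b \<in> ?B1" for b
    proof -
      have "c b \<le> c b * b (j b)" using j[OF that] by simp
      also have "\<dots> \<le> w (j b)" unfolding c lin_comb_def
        using that B by (intro member_le_sum) auto
      also have "\<dots> \<le> p (j b)" using w j[OF that] unfolding W_def by (metis (mono_tags, lifting) le_add2 mem_Collect_eq)
      also have "\<dots> \<le> s" unfolding s_def using that B by (intro member_le_sum) auto
      finally show ?thesis .
    qed
    then have "?c \<in> ?C" by auto
    ultimately show "w \<in> lin_comb ?B1 ` ?C" by (rule image_eqI)
  qed
  ultimately have "finite W" by (rule finite_surj)
  have "mon B = {x + y | x y. x \<in> mon ?B0 \<and> y \<in> mon ?B1}"
    unfolding mon_Un[symmetric] by (simp add: Int_Diff_Un)
  then have "fibre m p (lin u B) = (\<Union>w\<in>W. lin (u + w) ?B0)"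
  proof -
    assume mB: "mon B = {x + y | x y. x \<in> mon ?B0 \<and> y \<in> mon ?B1}"
    have supp: "x i = 0" if "x \<in> mon ?B0" "m \<le> i" for x i
      using mon_supp_in[OF _ that(1), of "{..<m}"] that(2) by (auto simp: supp_in_def)
    show ?thesis
    proof (intro equalityI subsetI)
      fix z assume "z \<in> fibre m p (lin u B)"
      then obtain x w where *: "z = u + (x + w)" "x \<in> mon ?B0" "w \<in> mon ?B1" "\<And>i. m \<le> i \<Longrightarrow> z i = p i"
        unfolding fibre_def lin_def mB by auto
      then have "w \<in> W" using supp[OF *(2)] by (auto simp: W_def)
      moreover have "z = (u + w) + x" using *(1) by (simp add: algebra_simps)
      ultimately show "z \<in> (\<Union>w\<in>W. lin (u + w) ?B0)" using *(2) by (auto simp: lin_def simp del: plus_fun_apply)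
    next
      fix z assume "z \<in> (\<Union>w\<in>W. lin (u + w) ?B0)"
      then obtain w x where *: "z = (u + w) + x" "w \<in> W" "x \<in> mon ?B0"
        by (auto simp: lin_def)
      then have "z = u + (x + w)" by (simp add: algebra_simps)
      moreover have "x + w \<in> mon B" using * unfolding mB W_def by blast
      moreover have "z i = p i" if "m \<le> i" for i using * supp[OF *(3) that] that by (auto simp: W_def)
      ultimately show "z \<in> fibre m p (lin u B)" by (auto simp: fibre_def lin_def)
    qed
  qed
  then have "fibre m p (lin u B) = (\<Union>w\<in>(+) u ` W. lin w ?B0)" by simp
  then show ?thesis using \<open>finite W\<close> by blast
qed

lemma box_card_UN_le:
  assumes "finite I"
  shows "box_card m (\<Union>i\<in>I. S i) n \<le> (\<Sum>i\<in>I. box_card m (S i) n)"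
proof -
  have eq: "{x \<in> (\<Union>i\<in>I. S i). \<forall>i<m. x i \<le> n} = (\<Union>i\<in>I. {x \<in> S i. \<forall>i<m. x i \<le> n})" by auto
  show ?thesis unfolding box_card_def eq by (rule card_UN_le[OF assms])
qed

text \<open>\<open>K\<close> comes from the monoids of the linear pieces alone, which are the same
  for all parameters; only \<open>c\<close> and \<open>U\<close> depend on \<open>p\<close>. The
  lower bound holds if the fibre contains a translate of a monoid with exponent above
  \<open>d\<close>; otherwise all exponents that occur are at most \<open>d\<close>.\<close>

lemma fibre_growth_gap:
  assumes "semilin Z"
  shows "\<exists>K. \<forall>p d. (\<exists>c. \<forall>n. box_card m (fibre m p Z) n \<le> c * (n + 1) ^ d) \<or>
    (\<exists>U. \<forall>n. n ^ (d + 1) \<le> box_card m (fibre m p Z) (U + K * n))"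
proof -
  obtain P where P: "finite P" "\<And>u B. (u, B) \<in> P \<Longrightarrow> finite B" "Z = (\<Union>(u, B)\<in>P. lin u B)"
    using assms unfolding semilin_def by blast
  let ?B0 = "\<lambda>B. B \<inter> supp_in {..<m}"
  have "\<forall>q\<in>P. \<exists>r K. \<forall>n. box_card m (mon (?B0 (snd q))) n \<le> K * (n + 1) ^ r \<and>
      n ^ r \<le> box_card m (mon (?B0 (snd q))) (K * n)"
  proof
    fix q assume "q \<in> P"
    then have "finite (?B0 (snd q))" using P(2)[of "fst q" "snd q"] by simp
    then show "\<exists>r K. \<forall>n. box_card m (mon (?B0 (snd q))) n \<le> K * (n + 1) ^ r \<and>
      n ^ r \<le> box_card m (mon (?B0 (snd q))) (K * n)"
      by (rule mon_box_growth) auto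
  qed
  then obtain r K where rK: "\<And>q n. q \<in> P \<Longrightarrow> box_card m (mon (?B0 (snd q))) n \<le> K q * (n + 1) ^ r q"
      "\<And>q n. q \<in> P \<Longrightarrow> n ^ r q \<le> box_card m (mon (?B0 (snd q))) (K q * n)"
    by metis
  define K' where "K' = (\<Sum>q\<in>P. K q)"
  have "(\<exists>c. \<forall>n. box_card m (fibre m p Z) n \<le> c * (n + 1) ^ d) \<or>
    (\<exists>U. \<forall>n. n ^ (d + 1) \<le> box_card m (fibre m p Z) (U + K' * n))" for p d
  proof -
    have "\<forall>q\<in>P. \<exists>W. finite W \<and> fibre m p (lin (fst q) (snd q)) = (\<Union>w\<in>W. lin w (?B0 (snd q)))"
      using P(2) by (intro ballI fibre_lin) (metis prod.collapse)
    then obtain W where W: "\<And>q. q \<in> P \<Longrightarrow> finite (W q)"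
      "\<And>q. q \<in> P \<Longrightarrow> fibre m p (lin (fst q) (snd q)) = (\<Union>w\<in>W q. lin w (?B0 (snd q)))"
      by metis
    have Z: "fibre m p Z = (\<Union>q\<in>P. \<Union>w\<in>W q. lin w (?B0 (snd q)))"
    proof -
      have "fibre m p Z = (\<Union>q\<in>P. fibre m p (lin (fst q) (snd q)))"
        by (auto simp: P(3) fibre_def)
      then show ?thesis using W(2) by simp
    qed
    have fin: "finite {z \<in> fibre m p Z. \<forall>i<m. z i \<le> n}" for n
      by (rule finite_box[where p = p]) (simp add: fibre_def)
    show ?thesis
    proof (cases "\<exists>q\<in>P. W q \<noteq> {} \<and> d < r q")
      case True
      then obtain q w where q: "q \<in> P" "w \<in> W q" "d + 1 \<le> r q" by fastforce
      have sub: "lin w (?B0 (snd q)) \<subseteq> fibre m p Z" unfolding Z using q by blast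
      have "n ^ (d + 1) \<le> box_card m (fibre m p Z) ((\<Sum>i<m. w i) + K' * n)" for n
      proof (cases "n = 0")
        case False
        have "K q \<le> K'" unfolding K'_def using q(1) P(1) by (intro member_le_sum) auto
        have "n ^ (d + 1) \<le> n ^ r q" using False q(3) by (intro power_increasing) auto
        also have "\<dots> \<le> box_card m (mon (?B0 (snd q))) (K q * n)" using rK(2) q(1) .
        also have "\<dots> \<le> box_card m (lin w (?B0 (snd q))) ((\<Sum>i<m. w i) + K q * n)"
          by (rule box_card_lin_lower) auto
        also have "\<dots> \<le> box_card m (fibre m p Z) ((\<Sum>i<m. w i) + K' * n)"
          unfolding box_card_def
        proof (intro card_mono fin subsetI)
          fix z assume z: "z \<in> {x \<in> lin w (?B0 (snd q)). \<forall>i<m. x i \<le> (\<Sum>i<m. w i) + K q * n}"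
          have "(\<Sum>i<m. w i) + K q * n \<le> (\<Sum>i<m. w i) + K' * n" using \<open>K q \<le> K'\<close> by simp
          then show "z \<in> {z \<in> fibre m p Z. \<forall>i<m. z i \<le> (\<Sum>i<m. w i) + K' * n}"
            using z sub by (auto intro: order_trans)
        qed
        finally show ?thesis .
      qed simp
      then show ?thesis by blast
    next
      case False
      have "box_card m (fibre m p Z) n \<le> (\<Sum>q\<in>P. card (W q) * K q) * (n + 1) ^ d" for n
      proof -
        have "box_card m (fibre m p Z) n \<le> (\<Sum>q\<in>P. \<Sum>w\<in>W q. box_card m (lin w (?B0 (snd q))) n)"
          unfolding Z using P(1) W(1)
          by (intro order_trans[OF box_card_UN_le] sum_mono box_card_UN_le) auto
        also have "\<dots> \<le> (\<Sum>q\<in>P. \<Sum>w\<in>W q. K q * (n + 1) ^ d)"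
        proof (intro sum_mono)
          fix q w assume q: "q \<in> P" "w \<in> W q"
          have "box_card m (lin w (?B0 (snd q))) n \<le> box_card m (mon (?B0 (snd q))) n"
            by (rule box_card_lin_upper) auto
          also have "\<dots> \<le> K q * (n + 1) ^ r q" using rK(1) q(1) .
          also have "\<dots> \<le> K q * (n + 1) ^ d"
            using False q by (intro mult_left_mono power_increasing) (auto simp: not_less)
          finally show "box_card m (lin w (?B0 (snd q))) n \<le> K q * (n + 1) ^ d" .
        qed
        also have "\<dots> = (\<Sum>q\<in>P. card (W q) * K q) * (n + 1) ^ d"
          by (simp add: sum_distrib_right mult.assoc)
        finally show ?thesis .
      qed
      then show ?thesis by blast
    qed
  qed
  then show ?thesis by blast
qed


section \<open>Condensations of a linear order\<close>

text \<open>For transitivity, the interval between \<open>a\<close> and \<open>c\<close> is covered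
  by the one between \<open>a\<close> and \<open>b\<close>, the one between \<open>b\<close> and
  \<open>c\<close>, and \<open>b\<close> itself, which contributes a single class.\<close>

lemma condense_equiv:
  assumes "strict_linear_order_on L r"
  shows "equiv L (condense L r q)"
proof (rule equivI)
  have tr: "trans r" and irr: "irrefl r" and tot: "total_on L r"
    using assms by (auto simp: strict_linear_order_on_def)
  show "condense L r q \<subseteq> L \<times> L" by (auto simp: condense_def)
  have "between L r a a = {}" for a
    using tr irr by (auto simp: between_def irrefl_def dest: transD)
  then show "refl_on L (condense L r q)"
    by (auto simp: refl_on_def condense_def quotient_def)
  have "between L r a b = between L r b a" for a b by (auto simp: between_def)
  then show "sym (condense L r q)" by (auto simp: sym_def condense_def)
  show "trans (condense L r q)"
  proof (rule transI)
    fix a b c assume *: "(a, b) \<in> condense L r q" "(b, c) \<in> condense L r q"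
    then have L: "a \<in> L" "b \<in> L" "c \<in> L" by (auto simp: condense_def)
    have "between L r a c \<subseteq> between L r a b \<union> between L r b c \<union> {b}"
    proof
      fix x assume x: "x \<in> between L r a c"
      then consider "x = b" | "(x, b) \<in> r" | "(b, x) \<in> r"
        using tot L by (auto simp: between_def total_on_def)
      then show "x \<in> between L r a b \<union> between L r b c \<union> {b}"
        using x L by cases (auto simp: between_def)
    qed
    then have "between L r a c // q \<subseteq> (between L r a b \<union> between L r b c \<union> {b}) // q"
      by (auto simp: quotient_def)
    moreover have "finite ((between L r a b \<union> between L r b c \<union> {b}) // q)"
    proof -
      have "(between L r a b \<union> between L r b c \<union> {b}) // q
        = between L r a b // q \<union> between L r b c // q \<union> {b} // q"
        by (auto simp: quotient_def)
      then show ?thesis using * by (simp add: condense_def quotient_def)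
    qed
    ultimately show "(a, c) \<in> condense L r q"
      using L by (auto simp: condense_def intro: finite_subset)
  qed
qed

lemma ex_greatest:
  assumes "strict_linear_order_on L r" "finite Y" "Y \<noteq> {}" "Y \<subseteq> L"
  shows "\<exists>y\<in>Y. \<forall>z\<in>Y. z \<noteq> y \<longrightarrow> (z, y) \<in> r"
  using assms(2-4)
proof (induct rule: finite_ne_induct)
  case (insert x Y)
  then obtain y where y: "y \<in> Y" "\<forall>z\<in>Y. z \<noteq> y \<longrightarrow> (z, y) \<in> r" by auto
  have tr: "trans r" and tot: "total_on L r"
    using assms(1) by (auto simp: strict_linear_order_on_def)
  have "x \<noteq> y" "x \<in> L" "y \<in> L" using insert y by auto
  then consider "(x, y) \<in> r" | "(y, x) \<in> r" using tot by (auto simp: total_on_def)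
  then show ?case
  proof cases
    case 1
    then show ?thesis using y by blast
  next
    case 2
    then have "\<forall>z\<in>Y. (z, x) \<in> r" using y tr by (metis transD)
    then show ?thesis by blast
  qed
qed auto

text \<open>The greatest element is split off repeatedly. Neighbours in the enumeration will bound
  the disjoint intervals of the counting argument.\<close>

lemma ex_increasing_enumeration:
  assumes "strict_linear_order_on L r" "finite Y" "Y \<subseteq> L" "card Y = Suc n"
  shows "\<exists>c. c ` {..n} = Y \<and> (\<forall>i j. i < j \<longrightarrow> j \<le> n \<longrightarrow> (c i, c j) \<in> r)"
  using assms(2-4)
proof (induct n arbitrary: Y)
  case 0
  then obtain y where "Y = {y}" by (auto simp: card_1_singleton_iff)
  then show ?case by (intro exI[of _ "\<lambda>_. y"]) auto
next
  case (Suc n)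
  then have "Y \<noteq> {}" by auto
  from ex_greatest[OF assms(1) Suc.prems(1) this Suc.prems(2)]
  obtain y where y: "y \<in> Y" "\<forall>z\<in>Y. z \<noteq> y \<longrightarrow> (z, y) \<in> r" by blast
  have "\<exists>c. c ` {..n} = Y - {y} \<and> (\<forall>i j. i < j \<longrightarrow> j \<le> n \<longrightarrow> (c i, c j) \<in> r)"
    using Suc.prems y by (intro Suc.hyps) auto
  then obtain c where c: "c ` {..n} = Y - {y}" "\<And>i j. i < j \<Longrightarrow> j \<le> n \<Longrightarrow> (c i, c j) \<in> r" by blast
  define c' where "c' = c(Suc n := y)"
  have "c' ` {..Suc n} = insert y (c ` {..n})"
    by (auto simp: c'_def atMost_Suc image_iff)
  then have "c' ` {..Suc n} = Y" using c(1) y(1) by auto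
  moreover have "(c' i, c' j) \<in> r" if "i < j" "j \<le> Suc n" for i j
  proof (cases "j = Suc n")
    case True
    have "c i \<in> Y - {y}" using that True c(1) by auto
    then show ?thesis using y(2) that True by (auto simp: c'_def)
  next
    case False
    then show ?thesis using that c(2) by (auto simp: c'_def)
  qed
  ultimately show ?case by blast
qed


subsection \<open>Finite ordinals\<close>

text \<open>The summand \<open>nat\<close> supplies finite well-orders of every size, here the
  cardinals of the images of initial segments of the naturals.\<close>

lemma ex_strict_mono_ordinals: "\<exists>w :: nat \<Rightarrow> ('a + nat) ordinal. \<forall>n. w n < w (Suc n)"
proof (rule exI[of _ "\<lambda>n. abs_ordinal (card_of (Inr ` {..<n}))"], rule allI)
  fix n
  have "(card_of ((Inr :: nat \<Rightarrow> 'a + nat) ` {..<n}), card_of ((Inr :: nat \<Rightarrow> 'a + nat) ` {..<Suc n})) \<in> ordLess"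
  proof -
    have "\<not> (\<exists>f. inj_on f ((Inr :: nat \<Rightarrow> 'a + nat) ` {..<Suc n}) \<and>
        f ` (Inr ` {..<Suc n}) \<subseteq> (Inr :: nat \<Rightarrow> 'a + nat) ` {..<n})"
    proof
      assume "\<exists>f. inj_on f ((Inr :: nat \<Rightarrow> 'a + nat) ` {..<Suc n}) \<and>
        f ` (Inr ` {..<Suc n}) \<subseteq> (Inr :: nat \<Rightarrow> 'a + nat) ` {..<n}"
      then have "card ((Inr :: nat \<Rightarrow> 'a + nat) ` {..<Suc n}) \<le> card ((Inr :: nat \<Rightarrow> 'a + nat) ` {..<n})"
        by (meson card_inj_on_le finite_imageI finite_lessThan)
      then show False by (simp add: card_image)
    qed
    then show ?thesis by (simp only: card_of_ordLess)
  qed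
  then show "abs_ordinal (card_of ((Inr :: nat \<Rightarrow> 'a + nat) ` {..<n})) < abs_ordinal (card_of (Inr ` {..<Suc n}))"
    by (subst less_ordinal.abs_eq) (simp_all add: card_of_refl)
qed

text \<open>\<open>LEAST\<close> yields a next ordinal only if a larger one exists. The strictly
  increasing sequence \<open>w\<close> dominates \<open>ord_of_nat\<close> and thus provides
  one.\<close>

lemma is_pred_ord_of_nat:
  "is_pred (ord_of_nat n :: ('a + nat) ordinal) (ord_of_nat (Suc n))"
proof -
  obtain w :: "nat \<Rightarrow> ('a + nat) ordinal" where w: "\<And>n. w n < w (Suc n)"
    using ex_strict_mono_ordinals by blast
  have le: "ord_of_nat n \<le> w n" for n
  proof (induct n)
    case 0
    show ?case by (simp add: Least_le)
  next
    case (Suc n)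
    then have "ord_of_nat n < w (Suc n)" using w[of n] by (rule le_less_trans)
    then show ?case by (simp add: Least_le)
  qed
  have "ord_of_nat n < w (Suc n)" using le[of n] w[of n] by (rule le_less_trans)
  then have "(ord_of_nat n :: ('a + nat) ordinal) < ord_of_nat (Suc n)"
    by simp (rule LeastI)
  moreover have "\<gamma> \<le> ord_of_nat n" if "\<gamma> < (ord_of_nat (Suc n) :: ('a + nat) ordinal)" for \<gamma>
    using not_less_Least[of \<gamma> "\<lambda>\<alpha>. ord_of_nat n < \<alpha>"] that by (simp add: not_less)
  ultimately show ?thesis by (auto simp: is_pred_def)
qed

text \<open>Fixes the ordinal type to that of \<open>VD_rank\<close>, so that inductions run over
  the naturals.\<close>

definition fin_VD_rel :: "'a set \<Rightarrow> 'a rel \<Rightarrow> nat \<Rightarrow> 'a rel" where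
  "fin_VD_rel L r n = VD_rel L r (ord_of_nat n :: ('a + nat) ordinal)"

lemma fin_VD_rel_Suc: "fin_VD_rel L r (Suc n) = condense L r (fin_VD_rel L r n)"
  unfolding fin_VD_rel_def by (rule VD_rel_succ) (rule is_pred_ord_of_nat)

lemma VD_rank_le:
  assumes "finite (L // fin_VD_rel L r n)"
  shows "VD_rank L r \<le> Fin (ord_of_nat n)"
proof -
  have "(LEAST \<alpha>. finite (L // VD_rel L r (\<alpha> :: ('a + nat) ordinal))) \<le> ord_of_nat n"
    using assms unfolding fin_VD_rel_def by (rule Least_le)
  moreover have "\<exists>\<alpha> :: ('a + nat) ordinal. finite (L // VD_rel L r \<alpha>)"
    using assms unfolding fin_VD_rel_def by blast
  ultimately show ?thesis unfolding VD_rank_def by simp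
qed


subsection \<open>Growth bounds the rank\<close>

text \<open>Elements of \<open>M\<close> are names for points of \<open>L\<close>, with
  \<open>\<nu>\<close> as size; growth counts names, and several may denote the same point. The
  convex set \<open>X\<close> is general because the induction passes to intervals. The constant
  \<open>K\<close> is the same for all intervals and all \<open>d\<close>, while the offset
  \<open>U\<close> may vary.\<close>

lemma finite_quotient_of_growth:
  fixes \<pi> :: "'b \<Rightarrow> 'a" and \<nu> :: "'b \<Rightarrow> nat"
  assumes ord: "strict_linear_order_on L r"
    and surj: "\<pi> ` M = L"
    and fin: "\<And>n. finite {a \<in> M. \<nu> a \<le> n}"
    and gap: "\<And>c c' d. c \<in> L \<Longrightarrow> c' \<in> L \<Longrightarrow>
      (\<exists>\<kappa>. \<forall>n. card {a \<in> M. (c, \<pi> a) \<in> r \<and> (\<pi> a, c') \<in> r \<and> \<nu> a \<le> n} \<le> \<kappa> * (n + 1) ^ d) \<or>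
      (\<exists>U. \<forall>n. n ^ (d + 1) \<le> card {a \<in> M. (c, \<pi> a) \<in> r \<and> (\<pi> a, c') \<in> r \<and> \<nu> a \<le> U + K * n})"
    and X: "X \<subseteq> L" "\<And>c c'. c \<in> X \<Longrightarrow> c' \<in> X \<Longrightarrow> between L r c c' \<subseteq> X"
    and growth: "\<And>n. card {a \<in> M. \<pi> a \<in> X \<and> \<nu> a \<le> n} \<le> \<kappa> * (n + 1) ^ d"
  shows "finite (X // fin_VD_rel L r d)"
  using X growth
proof (induct d arbitrary: X \<kappa>)
  case 0
  \<comment> \<open>For exponent 0 the bound is \<open>\<kappa>\<close> whatever the size, and each
    finite set of names has some bound on its sizes.\<close>
  have "card G \<le> \<kappa>" if G: "G \<subseteq> {a \<in> M. \<pi> a \<in> X}" "finite G" for G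
  proof -
    have "G \<subseteq> {a \<in> M. \<pi> a \<in> X \<and> \<nu> a \<le> (\<Sum>a\<in>G. \<nu> a)}"
      using G by (auto intro: member_le_sum)
    moreover have "finite {a \<in> M. \<pi> a \<in> X \<and> \<nu> a \<le> (\<Sum>a\<in>G. \<nu> a)}"
      using fin by (rule finite_subset[rotated]) auto
    ultimately have "card G \<le> card {a \<in> M. \<pi> a \<in> X \<and> \<nu> a \<le> (\<Sum>a\<in>G. \<nu> a)}"
      by (intro card_mono)
    also have "\<dots> \<le> \<kappa>" using 0(3)[of "\<Sum>a\<in>G. \<nu> a"] by simp
    finally show ?thesis .
  qed
  then have "finite {a \<in> M. \<pi> a \<in> X}"
    using finite_if_finite_subsets_card_bdd by blast
  then have "finite (\<pi> ` {a \<in> M. \<pi> a \<in> X})" by simp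
  moreover have "\<pi> ` {a \<in> M. \<pi> a \<in> X} = X" using surj 0(1) by auto
  ultimately show ?case by (simp add: quotient_def)
next
  case (Suc d)
  define q where "q = fin_VD_rel L r (Suc d)"
  have eq: "equiv L q" unfolding q_def fin_VD_rel_Suc using ord by (rule condense_equiv)
  have tr: "trans r" and irr: "irrefl r"
    using ord by (auto simp: strict_linear_order_on_def)
  show ?case
  proof (rule ccontr)
    \<comment> \<open>One more than the number of disjoint intervals with the lower growth bound
      that the final estimate allows in \<open>X\<close>.\<close>
    define T where "T = Suc (\<kappa> * (K + 1) ^ Suc d)"
    assume "infinite (X // fin_VD_rel L r (Suc d))"
    then have "infinite ((\<lambda>x. q `` {x}) ` X)" by (simp add: q_def quotient_def UNION_singleton_eq_range)
    \<comment> \<open>\<open>Suc T\<close> classes give as many inequivalent points, hence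
      \<open>T\<close> intervals between neighbours.\<close>
    then obtain Q where "Q \<subseteq> (\<lambda>x. q `` {x}) ` X" "card Q = Suc T" "finite Q"
      using infinite_arbitrarily_large by blast
    then obtain Y where Y: "Y \<subseteq> X" "inj_on (\<lambda>x. q `` {x}) Y" "Q = (\<lambda>x. q `` {x}) ` Y"
      by (meson subset_image_inj)
    then have cardY: "finite Y" "card Y = Suc T"
      using \<open>card Q = Suc T\<close> \<open>finite Q\<close> by (auto simp: card_image finite_image_iff)
    obtain c where c: "c ` {..T} = Y" "\<And>i j. i < j \<Longrightarrow> j \<le> T \<Longrightarrow> (c i, c j) \<in> r"
      using ex_increasing_enumeration[OF ord cardY(1) _ cardY(2)] Y(1) Suc.prems(1) by blast
    have cX: "c i \<in> X" "c i \<in> L" if "i \<le> T" for i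
      using c(1) that Y(1) Suc.prems(1) by auto
    define J where "J i n = {a \<in> M. (c i, \<pi> a) \<in> r \<and> (\<pi> a, c (Suc i)) \<in> r \<and> \<nu> a \<le> n}" for i n
    \<comment> \<open>If an interval had growth with exponent \<open>d\<close>, then by induction it
      would meet finitely many classes of \<open>fin_VD_rel L r d\<close>, and its end points would
      be equivalent under \<open>q\<close>.\<close>
    have big: "\<exists>U. \<forall>n. n ^ Suc d \<le> card (J i (U + K * n))" if i: "i < T" for i
    proof (rule ccontr)
      assume not_big: "\<not> ?thesis"
      have r: "(c i, c (Suc i)) \<in> r" using c(2) i by simp
      have L: "c i \<in> L" "c (Suc i) \<in> L" using cX i by auto
      obtain \<kappa>' where \<kappa>': "\<And>n. card (J i n) \<le> \<kappa>' * (n + 1) ^ d"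
        using gap[OF L, of d] not_big unfolding J_def by auto
      have btw: "between L r (c i) (c (Suc i)) = {x \<in> L. (c i, x) \<in> r \<and> (x, c (Suc i)) \<in> r}"
        using r tr irr unfolding between_def irrefl_def by (blast dest: transD)
      have "finite (between L r (c i) (c (Suc i)) // fin_VD_rel L r d)"
      proof (rule Suc.hyps)
        show "between L r (c i) (c (Suc i)) \<subseteq> L" by (auto simp: between_def)
        show "between L r a b \<subseteq> between L r (c i) (c (Suc i))"
          if "a \<in> between L r (c i) (c (Suc i))" "b \<in> between L r (c i) (c (Suc i))" for a b
          using that tr unfolding btw unfolding between_def by (blast dest: transD)
        have "{a \<in> M. \<pi> a \<in> between L r (c i) (c (Suc i)) \<and> \<nu> a \<le> n} = J i n" for n
          unfolding btw J_def using surj by auto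
        then show "card {a \<in> M. \<pi> a \<in> between L r (c i) (c (Suc i)) \<and> \<nu> a \<le> n} \<le> \<kappa>' * (n + 1) ^ d" for n
          using \<kappa>' by simp
      qed
      then have "(c i, c (Suc i)) \<in> q"
        using L by (simp add: q_def fin_VD_rel_Suc condense_def)
      then have "q `` {c i} = q `` {c (Suc i)}" using eq by (rule equiv_class_eq[rotated])
      then have "c i = c (Suc i)" using Y(2) c(1) i by (auto simp: inj_on_def)
      then show False using r irr by (simp add: irrefl_def)
    qed
    then obtain U where U: "\<And>i n. i < T \<Longrightarrow> n ^ Suc d \<le> card (J i (U i + K * n))" by metis
    define V where "V = (\<Sum>i<T. U i)"
    \<comment> \<open>This choice absorbs all offsets: \<open>V + K * n + 1\<close> is exactly
      \<open>(K + 1) * n\<close>, so that \<open>n ^ Suc d\<close> cancels at the end.\<close>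
    define n where "n = Suc V"
    have V: "U i \<le> V" if "i < T" for i unfolding V_def using that by (intro member_le_sum) auto
    have fin_J: "finite (J i k)" for i k
      unfolding J_def using fin by (rule finite_subset[rotated]) auto
    have disj: "J i k \<inter> J j k = {}" if "i < j" "j < T" for i j k
    proof -
      have *: "c (Suc i) = c j \<or> (c (Suc i), c j) \<in> r"
        using that c(2)[of "Suc i" j] by (cases "Suc i = j") auto
      have False if "a \<in> J i k" "a \<in> J j k" for a
      proof -
        have "(\<pi> a, c (Suc i)) \<in> r" "(c j, \<pi> a) \<in> r" using that by (simp_all add: J_def)
        with * have "(\<pi> a, \<pi> a) \<in> r" using transD[OF tr] by metis
        then show False using irr by (simp add: irrefl_def)
      qed
      then show ?thesis by blast
    qed
    have "T * n ^ Suc d = (\<Sum>i<T. n ^ Suc d)" by simp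
    also have "\<dots> \<le> (\<Sum>i<T. card (J i (V + K * n)))"
    proof (rule sum_mono)
      fix i assume i: "i \<in> {..<T}"
      have "n ^ Suc d \<le> card (J i (U i + K * n))" using U i by simp
      also have "\<dots> \<le> card (J i (V + K * n))"
        using V[of i] i by (intro card_mono fin_J) (auto simp: J_def)
      finally show "n ^ Suc d \<le> card (J i (V + K * n))" .
    qed
    also have "\<dots> = card (\<Union>i<T. J i (V + K * n))"
    proof (rule card_UN_disjoint[symmetric])
      show "\<forall>i\<in>{..<T}. \<forall>j\<in>{..<T}. i \<noteq> j \<longrightarrow> J i (V + K * n) \<inter> J j (V + K * n) = {}"
      proof (intro ballI impI)
        fix i j assume "i \<in> {..<T}" "j \<in> {..<T}" "i \<noteq> j"
        then consider "i < j" "j < T" | "j < i" "i < T" by fastforce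
        then show "J i (V + K * n) \<inter> J j (V + K * n) = {}"
          by cases (use disj[of i j] disj[of j i] in \<open>simp_all add: Int_commute\<close>)
      qed
    qed (use fin_J in auto)
    also have "\<dots> \<le> card {a \<in> M. \<pi> a \<in> X \<and> \<nu> a \<le> V + K * n}"
    proof (rule card_mono)
      show "finite {a \<in> M. \<pi> a \<in> X \<and> \<nu> a \<le> V + K * n}"
        using fin by (rule finite_subset[rotated]) auto
      have "a \<in> M \<and> \<pi> a \<in> X \<and> \<nu> a \<le> V + K * n" if "i < T" "a \<in> J i (V + K * n)" for i a
      proof -
        have "\<pi> a \<in> between L r (c i) (c (Suc i))"
          using that surj by (auto simp: J_def between_def)
        also have "\<dots> \<subseteq> X" using that cX by (intro Suc.prems(2)) auto
        finally show ?thesis using that by (simp add: J_def)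
      qed
      then show "(\<Union>i<T. J i (V + K * n)) \<subseteq> {a \<in> M. \<pi> a \<in> X \<and> \<nu> a \<le> V + K * n}" by blast
    qed
    also have "\<dots> \<le> \<kappa> * (V + K * n + 1) ^ Suc d" by (rule Suc.prems(3))
    also have "V + K * n + 1 = (K + 1) * n" by (simp add: n_def)
    finally have "T * n ^ Suc d \<le> (\<kappa> * (K + 1) ^ Suc d) * n ^ Suc d"
      by (simp only: power_mult_distrib mult.assoc)
    then have "T \<le> \<kappa> * (K + 1) ^ Suc d" by (simp add: n_def del: power_Suc)
    then show False by (simp add: T_def)
  qed
qed


section \<open>Interpretations in Presburger arithmetic\<close>

text \<open>The valuation inside \<open>holds\<close>, which is at the same time the encoding of a
  list as a function of finite support.\<close>

definition list_env :: "nat list \<Rightarrow> nat \<Rightarrow> nat" where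
  "list_env xs = (\<lambda>i. if i < length xs then xs ! i else 0)"

lemma list_env_inject: "length xs = length ys \<Longrightarrow> list_env xs = list_env ys \<longleftrightarrow> xs = ys"
  by (metis list_env_def nth_equalityI)

lemma list_env_append: "list_env (xs @ ys) i = (if i < length xs then xs ! i else list_env ys (i - length xs))"
  by (auto simp: list_env_def nth_append)

lemma sat_list_env: "sat (list_env xs) \<phi> \<longleftrightarrow> holds \<phi> xs"
  by (simp add: holds_def list_env_def)

definition max_entry :: "nat list \<Rightarrow> nat" where
  "max_entry xs = Max (insert 0 (set xs))"

lemma max_entry_le_iff: "max_entry xs \<le> n \<longleftrightarrow> (\<forall>i<length xs. xs ! i \<le> n)"
  by (auto simp: max_entry_def all_set_conv_all_nth)

text \<open>All open intervals are fibres of one definable set, with the names of their end points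
  as parameters; hence a single \<open>K\<close>.\<close>

lemma interval_growth_gap:
  assumes fv: "fv D \<subseteq> {..<m}" "fv R \<subseteq> {..<2 * m}"
  shows "\<exists>K. \<forall>a b d. length a = m \<longrightarrow> length b = m \<longrightarrow>
      (\<exists>c. \<forall>n. card {x \<in> dom_set m D. holds R (a @ x) \<and> holds R (x @ b) \<and> max_entry x \<le> n} \<le> c * (n + 1) ^ d) \<or>
      (\<exists>U. \<forall>n. n ^ (d + 1) \<le>
        card {x \<in> dom_set m D. holds R (a @ x) \<and> holds R (x @ b) \<and> max_entry x \<le> U + K * n})"
proof -
  \<comment> \<open>The \<open>3 * m\<close> coordinates consist of the blocks \<open>x\<close>,
    \<open>a\<close>, \<open>b\<close> in this order, so that \<open>x\<close> comes first as
    \<open>fibre\<close> demands. Through \<open>\<sigma>\<close> the formula \<open>R\<close> reads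
    \<open>a @ x\<close>, through \<open>\<tau>\<close> it reads \<open>x @ b\<close>.\<close>
  define \<sigma> where "\<sigma> y = (if y < m then m + y else y - m)" for y
  define \<tau> where "\<tau> y = (if y < m then y else m + y)" for y
  define Z where "Z = {z \<in> supp_in {..<3 * m}.
    sat (\<lambda>y. z y) D \<and> sat (\<lambda>y. z (\<sigma> y)) R \<and> sat (\<lambda>y. z (\<tau> y)) R}"
  have "y < 3 * m" if "y \<in> fv D" for y using fv that by fastforce
  moreover have "\<sigma> y < 3 * m" "\<tau> y < 3 * m" if "y \<in> fv R" for y
    using subsetD[OF fv(2) that] by (auto simp: \<sigma>_def \<tau>_def)
  ultimately have "semilin Z"
    unfolding Z_def by (intro semilin_Collect_conj semilin_definable)
  then obtain K where K: "\<And>p d. (\<exists>c. \<forall>n. box_card m (fibre m p Z) n \<le> c * (n + 1) ^ d) \<or>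
      (\<exists>U. \<forall>n. n ^ (d + 1) \<le> box_card m (fibre m p Z) (U + K * n))"
    using fibre_growth_gap[of Z m] by blast
  have card_eq: "card {x \<in> dom_set m D. holds R (a @ x) \<and> holds R (x @ b) \<and> max_entry x \<le> n} =
      box_card m (fibre m (list_env (replicate m 0 @ a @ b)) Z) n" (is "card ?X = _")
    if [simp]: "length a = m" "length b = m" for a b n
  proof -
    \<comment> \<open>The zeros fill the block of \<open>x\<close>, which \<open>fibre\<close> does
      not compare; they only move \<open>a\<close> and \<open>b\<close> to their places.\<close>
    let ?p = "list_env (replicate m 0 @ a @ b)"
    have Z_iff: "list_env (x @ a @ b) \<in> Z \<longleftrightarrow> holds D x \<and> holds R (a @ x) \<and> holds R (x @ b)"
      if [simp]: "length x = m" for x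
    proof -
      have "sat (list_env (x @ a @ b)) D \<longleftrightarrow> sat (list_env x) D"
        using fv(1) by (intro sat_cong) (auto simp: list_env_def nth_append)
      moreover have "sat (\<lambda>y. list_env (x @ a @ b) (\<sigma> y)) R \<longleftrightarrow> sat (list_env (a @ x)) R"
        using fv(2) by (intro sat_cong) (auto simp: list_env_def nth_append \<sigma>_def)
      moreover have "sat (\<lambda>y. list_env (x @ a @ b) (\<tau> y)) R \<longleftrightarrow> sat (list_env (x @ b)) R"
        using fv(2) by (intro sat_cong) (auto simp: list_env_def nth_append \<tau>_def)
      moreover have "list_env (x @ a @ b) \<in> supp_in {..<3 * m}"
        by (auto simp: supp_in_def list_env_def)
      ultimately show ?thesis by (simp add: Z_def sat_list_env)
    qed
    have "{z \<in> fibre m ?p Z. \<forall>i<m. z i \<le> n} = (\<lambda>x. list_env (x @ a @ b)) ` ?X"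
    proof (intro equalityI subsetI)
      fix z assume z: "z \<in> {z \<in> fibre m ?p Z. \<forall>i<m. z i \<le> n}"
      define x where "x = map z [0..<m]"
      have [simp]: "length x = m" by (simp add: x_def)
      have "list_env (x @ a @ b) i = z i" for i
      proof (cases "i < m")
        case True
        then show ?thesis by (simp add: list_env_append x_def)
      next
        case False
        then have "z i = ?p i" using z by (simp add: fibre_def)
        then show ?thesis using False by (simp add: list_env_append)
      qed
      then have zx: "z = list_env (x @ a @ b)" by auto
      moreover have "x \<in> ?X"
      proof -
        have "list_env (x @ a @ b) \<in> Z" using z unfolding zx fibre_def by blast
        moreover have "max_entry x \<le> n" using z by (simp add: max_entry_le_iff) (simp add: x_def)
        ultimately show ?thesis using Z_iff[of x] by (simp add: dom_set_def)
      qed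
      ultimately show "z \<in> (\<lambda>x. list_env (x @ a @ b)) ` ?X" by blast
    next
      fix z assume "z \<in> (\<lambda>x. list_env (x @ a @ b)) ` ?X"
      then obtain x where x: "x \<in> ?X" and z: "z = list_env (x @ a @ b)" by blast
      then have len: "length x = m" by (simp add: dom_set_def)
      have "z \<in> Z" using x Z_iff[OF len] by (simp add: z dom_set_def)
      moreover have "z i = ?p i" if "i \<ge> m" for i
        using that len by (simp add: z list_env_append)
      moreover have "z i \<le> n" if "i < m" for i
        using that len x by (simp add: z list_env_append max_entry_le_iff)
      ultimately show "z \<in> {z \<in> fibre m ?p Z. \<forall>i<m. z i \<le> n}"
        by (simp add: fibre_def)
    qed
    moreover have "inj_on (\<lambda>x. list_env (x @ a @ b)) ?X"
      by (auto simp: inj_on_def dom_set_def list_env_inject)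
    ultimately show ?thesis by (simp add: box_card_def card_image)
  qed
  show ?thesis
  proof (intro exI[of _ K] allI impI)
    fix a b :: "nat list" and d assume len: "length a = m" "length b = m"
    show "(\<exists>c. \<forall>n. card {x \<in> dom_set m D. holds R (a @ x) \<and> holds R (x @ b) \<and> max_entry x \<le> n} \<le> c * (n + 1) ^ d) \<or>
      (\<exists>U. \<forall>n. n ^ (d + 1) \<le>
        card {x \<in> dom_set m D. holds R (a @ x) \<and> holds R (x @ b) \<and> max_entry x \<le> U + K * n})"
      unfolding card_eq[OF len] by (rule K)
  qed
qed

lemma card_dom_set_le:
  "finite {x \<in> dom_set m D. max_entry x \<le> n}"
  "card {x \<in> dom_set m D. max_entry x \<le> n} \<le> (n + 1) ^ m"
proof -
  let ?Y = "{xs. set xs \<subseteq> {..n} \<and> length xs = m}"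
  have sub: "{x \<in> dom_set m D. max_entry x \<le> n} \<subseteq> ?Y"
    by (auto simp: dom_set_def max_entry_def)
  have fin: "finite ?Y" by (rule finite_lists_length_eq) simp
  show "finite {x \<in> dom_set m D. max_entry x \<le> n}" using sub fin by (rule finite_subset)
  have "card {x \<in> dom_set m D. max_entry x \<le> n} \<le> card ?Y" using fin sub by (rule card_mono)
  also have "\<dots> = (n + 1) ^ m" by (simp add: card_lists_length_eq)
  finally show "card {x \<in> dom_set m D. max_entry x \<le> n} \<le> (n + 1) ^ m" .
qed

theorem theorem3:
  fixes L :: "'a set" and r :: "'a rel" and m :: nat
  assumes "m \<ge> 1"
    and "strict_linear_order_on L r"
    and "interpretable m L r"
  shows "VD_rank L r \<le> Fin (ord_of_nat m)"
proof -
  obtain D E R h where fv: "fv D \<subseteq> {..<m}" "fv R \<subseteq> {..<2 * m}"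
    and bij: "bij_betw h (dom_set m D // eq_rel m D E) L"
    and R: "\<forall>a \<in> dom_set m D. \<forall>b \<in> dom_set m D.
      (h (eq_rel m D E `` {a}), h (eq_rel m D E `` {b})) \<in> r \<longleftrightarrow> holds R (a @ b)"
    using assms(3) unfolding interpretable_def by (elim exE conjE) (rule that)
  define \<pi> where "\<pi> a = h (eq_rel m D E `` {a})" for a
  have surj: "\<pi> ` dom_set m D = L"
    using bij_betw_imp_surj_on[OF bij] by (auto simp: \<pi>_def quotient_def)
  obtain K where K: "\<And>a b d. length a = m \<Longrightarrow> length b = m \<Longrightarrow>
      (\<exists>c. \<forall>n. card {x \<in> dom_set m D. holds R (a @ x) \<and> holds R (x @ b) \<and> max_entry x \<le> n} \<le> c * (n + 1) ^ d) \<or>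
      (\<exists>U. \<forall>n. n ^ (d + 1) \<le>
        card {x \<in> dom_set m D. holds R (a @ x) \<and> holds R (x @ b) \<and> max_entry x \<le> U + K * n})"
    using interval_growth_gap[OF fv] by blast
  have gap: "(\<exists>\<kappa>. \<forall>n. card {x \<in> dom_set m D. (c, \<pi> x) \<in> r \<and> (\<pi> x, c') \<in> r \<and> max_entry x \<le> n} \<le> \<kappa> * (n + 1) ^ d) \<or>
      (\<exists>U. \<forall>n. n ^ (d + 1) \<le> card {x \<in> dom_set m D. (c, \<pi> x) \<in> r \<and> (\<pi> x, c') \<in> r \<and> max_entry x \<le> U + K * n})"
    if "c \<in> L" "c' \<in> L" for c c' d
  proof -
    have "c \<in> \<pi> ` dom_set m D" "c' \<in> \<pi> ` dom_set m D" using that surj by simp_all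
    then obtain a b where ab: "a \<in> dom_set m D" "b \<in> dom_set m D" "c = \<pi> a" "c' = \<pi> b"
      by blast
    have "{x \<in> dom_set m D. (c, \<pi> x) \<in> r \<and> (\<pi> x, c') \<in> r \<and> max_entry x \<le> n} =
        {x \<in> dom_set m D. holds R (a @ x) \<and> holds R (x @ b) \<and> max_entry x \<le> n}" for n
      using R ab unfolding \<pi>_def by auto
    then show ?thesis using K[of a b d] ab(1,2) by (simp add: dom_set_def)
  qed
  \<comment> \<open>\<open>L\<close> itself is convex and has at most \<open>(n + 1) ^ m\<close>
    names with entries up to \<open>n\<close>, which is growth with exponent \<open>m\<close> and
    factor 1.\<close>
  have "finite (L // fin_VD_rel L r m)"
  proof (rule finite_quotient_of_growth[OF assms(2) surj card_dom_set_le(1) gap])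
    show "between L r c c' \<subseteq> L" for c c' by (auto simp: between_def)
    have "{a \<in> dom_set m D. \<pi> a \<in> L \<and> max_entry a \<le> n} = {a \<in> dom_set m D. max_entry a \<le> n}" for n
      using surj by auto
    then show "card {a \<in> dom_set m D. \<pi> a \<in> L \<and> max_entry a \<le> n} \<le> 1 * (n + 1) ^ m" for n
      using card_dom_set_le(2)[of m D n] by simp
  qed auto
  then show ?thesis by (rule VD_rank_le)
qed

end
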